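(* Let $f(x)=\mathbb{E}_\xi[f(x,\xi)]$ be convex and $L_0$-Lipschitz continuous on $\mathbb{R}^d$, with minimizer $x^*$, and suppose that $\mathbb{E}_\xi[(f(x,\xi)-f(x))^2]\le\sigma_0^2$ for all $x\in\mathbb{R}^d$, where $\sigma_0>0$. Run the stochastic one-point residual feedback algorithm from $x_1$ for $T$ iterations with smoothing parameter $\alpha>0$ and step size $0<\eta\le\frac{\alpha}{3dL_0}$. Then $$\frac1T\sum_{t=1}^T\mathbb{E}\big[f(x_t)-f(x^* )\big]\le\frac{\|x_1-x^*\|^2}{T\eta}+24\eta c_0dL_0^2+\frac{24\eta d^2\sigma_0^2}{\alpha^2}+L_0\alpha .$$
   Context: $\|\cdot\|$ is the Euclidean norm on $\mathbb{R}^d$, $d\ge1$. A function $f$ is $L_0$-Lipschitz continuous ($L_0>0$) if $|f(x)-f(y)|\le L_0\|x-y\|$ for all $x,y$. $\xi$ is a random variable and $f(\cdot,\xi)$ is the random objective. $x^*$ denotes a minimizer of $f$ over $\mathbb{R}^d$. $c_0>0$ is a fixed universal numerical constant such that for every $d\ge1$, every $M>0$ and every $M$-Lipschitz function $h:\mathbb{R}^d\to\mathbb{R}$, if $u$ is uniformly distributed on the Euclidean unit sphere of $\mathbb{R}^d$ then $\sqrt{\mathbb{E}[(h(u)-\mathbb{E}[h(u)])^4]}\le c_0M^2/d$. Stochastic one-point residual feedback algorithm: given $x_1\in\mathbb{R}^d$, step size $\eta>0$, smoothing parameter $\alpha>0$ and iteration number $T$, set $x_0=x_1$, let $u_0,\dots,u_T$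 be independent and uniformly distributed on the unit sphere of $\mathbb{R}^d$, let $\xi_0,\dots,\xi_T$ be independent copies of $\xi$, independent of the $u_t$, and for $t=1,\dots,T$ put $$\tilde g_t=d\cdot\frac{f(x_t+\alpha u_t,\xi_t)-f(x_{t-1}+\alpha u_{t-1},\xi_{t-1})}{\alpha}\,u_t,\qquad x_{t+1}=x_t-\eta\tilde g_t .$$ Expectations $\mathbb{E}$ are over all the $u_t,\xi_t$. *)

theory Defs
  imports "HOL-Probability.Probability"
begin

text \<open>
  Uniform distribution on the Euclidean unit sphere. The surface measure of a subset of the sphere
  is, up to a constant factor, the volume of the cone over it, so the normalised surface measure is
  the image of the uniform distribution on the unit ball under radial projection. The centre of the
  ball is a null set.
\<close>

definition uniform_sphere :: "'a::euclidean_space measure" where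
  "uniform_sphere =
     distr (uniform_measure lborel (cball 0 1)) borel (\<lambda>x. x /\<^sub>R norm x)"

text \<open>
  The same distribution for a dimension \<open>d\<close> that is a term and not a type: here \<open>\<real>\<^sup>d\<close> is the set of
  functions \<open>{..<d} \<rightarrow>\<^sub>E UNIV\<close>, with Euclidean norm \<open>\<lambda>x. L2_set x {..<d}\<close> and Lebesgue measure
  \<open>\<Pi>\<^sub>M i\<in>{..<d}. lborel\<close>. It is needed because the constant below has to serve all dimensions.
\<close>

definition uniform_sphere_coord :: "nat \<Rightarrow> (nat \<Rightarrow> real) measure" where
  "uniform_sphere_coord d =
     distr (uniform_measure (\<Pi>\<^sub>M i\<in>{..<d}. lborel) {x \<in> {..<d} \<rightarrow>\<^sub>E UNIV. L2_set x {..<d} \<le> 1})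
       (\<Pi>\<^sub>M i\<in>{..<d}. borel) (\<lambda>x. \<lambda>i\<in>{..<d}. x i / L2_set x {..<d})"

definition sphere_moment_constant :: "real \<Rightarrow> bool" where
  "sphere_moment_constant c \<longleftrightarrow>
     (\<forall>d\<ge>1. \<forall>M>0. \<forall>h::(nat \<Rightarrow> real) \<Rightarrow> real.
        (\<forall>x\<in>{..<d} \<rightarrow>\<^sub>E UNIV. \<forall>y\<in>{..<d} \<rightarrow>\<^sub>E UNIV.
           \<bar>h x - h y\<bar> \<le> M * L2_set (\<lambda>i. x i - y i) {..<d}) \<longrightarrow>
        sqrt (\<integral>u. (h u - (\<integral>v. h v \<partial>uniform_sphere_coord d)) ^ 4 \<partial>uniform_sphere_coord d)
          \<le> c * M\<^sup>2 / real d)"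

text \<open>
  Independence of two random variables whose value types may differ (\<^const>\<open>prob_space.indep_var\<close>
  requires them to coincide).
\<close>

definition indep_rv ::
  "'w measure \<Rightarrow> 'b measure \<Rightarrow> ('w \<Rightarrow> 'b) \<Rightarrow> 'c measure \<Rightarrow> ('w \<Rightarrow> 'c) \<Rightarrow> bool" where
  "indep_rv M A X B Y \<longleftrightarrow> X \<in> measurable M A \<and> Y \<in> measurable M B \<and>
     prob_space.indep_set M {X -` S \<inter> space M | S. S \<in> sets A} {Y -` S \<inter> space M | S. S \<in> sets B}"

text \<open>
  One-point residual gradient estimator: \<open>x, u, s\<close> are the current iterate, direction and
  noise sample, and \<open>x', u', s'\<close> the previous ones.
\<close>

definition residual_grad ::
  "('a::euclidean_space \<Rightarrow> 's \<Rightarrow> real) \<Rightarrow> real \<Rightarrow> 'a \<Rightarrow> 'a \<Rightarrow> 's \<Rightarrow> 'a \<Rightarrow> 'a \<Rightarrow> 's \<Rightarrow> 'a" where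
  "residual_grad f \<alpha> x u s x' u' s' =
     (real DIM('a) * ((f (x + \<alpha> *\<^sub>R u) s - f (x' + \<alpha> *\<^sub>R u') s') / \<alpha>)) *\<^sub>R u"

fun residual_iterate ::
  "('a::euclidean_space \<Rightarrow> 's \<Rightarrow> real) \<Rightarrow> real \<Rightarrow> real \<Rightarrow> 'a \<Rightarrow> (nat \<Rightarrow> 'a) \<Rightarrow> (nat \<Rightarrow> 's) \<Rightarrow> nat \<Rightarrow> 'a"
where
  "residual_iterate f \<eta> \<alpha> x1 u s 0 = x1"
| "residual_iterate f \<eta> \<alpha> x1 u s (Suc 0) = x1"
| "residual_iterate f \<eta> \<alpha> x1 u s (Suc (Suc t)) =
     residual_iterate f \<eta> \<alpha> x1 u s (Suc t) - \<eta> *\<^sub>R residual_grad f \<alpha>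
       (residual_iterate f \<eta> \<alpha> x1 u s (Suc t)) (u (Suc t)) (s (Suc t))
       (residual_iterate f \<eta> \<alpha> x1 u s t) (u t) (s t)"

text \<open>
  The two presentations of the uniform distribution agree in any orthonormal coordinates, so a
  \<^const>\<open>sphere_moment_constant\<close> works in every Euclidean space.
\<close>

context
  fixes b :: "nat \<Rightarrow> 'a::euclidean_space"
  assumes b: "bij_betw b {..<DIM('a)} Basis"
begin

lemma lborel_coord:
  "(lborel :: 'a measure) =
     distr (\<Pi>\<^sub>M i\<in>{..<DIM('a)}. lborel) borel (\<lambda>x. \<Sum>i<DIM('a). x i *\<^sub>R b i)"
proof (rule lborel_eqI)
  let ?D = "{..<DIM('a)}"
  let ?e = "\<lambda>x::nat \<Rightarrow> real. \<Sum>i\<in>?D. x i *\<^sub>R b i"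
  interpret P: product_sigma_finite "\<lambda>_::nat. lborel :: real measure"
    by standard
  fix l u :: 'a
  assume le: "\<And>c. c \<in> Basis \<Longrightarrow> l \<bullet> c \<le> u \<bullet> c"
  have bB: "b i \<in> Basis" if "i \<in> ?D" for i
    using b that by (auto simp: bij_betw_def)
  have inner: "?e x \<bullet> b j = x j" if "j \<in> ?D" for x j
  proof -
    have "?e x \<bullet> b j = (\<Sum>i\<in>?D. x i * (b i \<bullet> b j))"
      by (simp add: inner_sum_left)
    also have "\<dots> = (\<Sum>i\<in>?D. if i = j then x i else 0)"
    proof (rule sum.cong)
      fix i assume i: "i \<in> ?D"
      have "b i = b j \<longleftrightarrow> i = j"
        using b i that by (auto simp: bij_betw_def inj_on_def)
      then show "x i * (b i \<bullet> b j) = (if i = j then x i else 0)"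
        using inner_Basis[OF bB[OF i] bB[OF that]] by auto
    qed simp
    also have "\<dots> = x j"
      using that by simp
    finally show ?thesis .
  qed
  have box: "?e x \<in> box l u \<longleftrightarrow> (\<forall>i\<in>?D. l \<bullet> b i < x i \<and> x i < u \<bullet> b i)" for x
  proof -
    have "?e x \<in> box l u \<longleftrightarrow> (\<forall>c\<in>b ` ?D. l \<bullet> c < ?e x \<bullet> c \<and> ?e x \<bullet> c < u \<bullet> c)"
      using b by (simp add: mem_box bij_betw_def)
    then show ?thesis
      by (simp add: inner)
  qed
  have pre: "?e -` box l u \<inter> space (\<Pi>\<^sub>M i\<in>?D. (lborel::real measure))
      = (\<Pi>\<^sub>E i\<in>?D. box (l \<bullet> b i) (u \<bullet> b i))"
    using box by (auto simp: space_PiM PiE_def Pi_def)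
  have meas: "?e \<in> (\<Pi>\<^sub>M i\<in>?D. (lborel::real measure)) \<rightarrow>\<^sub>M borel"
    by measurable
  have "emeasure (distr (\<Pi>\<^sub>M i\<in>?D. lborel) borel ?e) (box l u)
      = emeasure (\<Pi>\<^sub>M i\<in>?D. (lborel::real measure)) (\<Pi>\<^sub>E i\<in>?D. box (l \<bullet> b i) (u \<bullet> b i))"
    by (simp add: emeasure_distr[OF meas] pre)
  also have "\<dots> = (\<Prod>i\<in>?D. emeasure lborel (box (l \<bullet> b i) (u \<bullet> b i)))"
    by (rule P.emeasure_PiM) auto
  also have "\<dots> = (\<Prod>i\<in>?D. ennreal ((u - l) \<bullet> b i))"
  proof (rule prod.cong)
    fix i assume "i \<in> ?D"
    then show "emeasure lborel (box (l \<bullet> b i) (u \<bullet> b i)) = ennreal ((u - l) \<bullet> b i)"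
      using le[OF bB] by (simp add: inner_diff_left)
  qed simp
  also have "\<dots> = ennreal (\<Prod>i\<in>?D. (u - l) \<bullet> b i)"
    using le bB by (intro prod_ennreal) (simp add: inner_diff_left)
  also have "(\<Prod>i\<in>?D. (u - l) \<bullet> b i) = (\<Prod>c\<in>Basis. (u - l) \<bullet> c)"
    by (rule prod.reindex_bij_betw[OF b])
  finally show "emeasure (distr (\<Pi>\<^sub>M i\<in>?D. lborel) borel ?e) (box l u)
      = ennreal (\<Prod>c\<in>Basis. (u - l) \<bullet> c)" .
qed simp

lemma norm_coord: "norm (\<Sum>i<DIM('a). x i *\<^sub>R b i) = L2_set x {..<DIM('a)}"
proof -
  let ?D = "{..<DIM('a)}"
  have bB: "b i \<in> Basis" if "i \<in> ?D" for i
    using b that by (auto simp: bij_betw_def)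
  have ort: "b i \<bullet> b j = (if i = j then 1 else 0)" if "i \<in> ?D" "j \<in> ?D" for i j
  proof -
    have "b i = b j \<longleftrightarrow> i = j"
      using b that by (auto simp: bij_betw_def inj_on_def)
    then show ?thesis
      using inner_Basis[OF bB[OF that(1)] bB[OF that(2)]] by auto
  qed
  have "(\<Sum>i\<in>?D. x i *\<^sub>R b i) \<bullet> (\<Sum>j\<in>?D. x j *\<^sub>R b j)
      = (\<Sum>i\<in>?D. \<Sum>j\<in>?D. x i * (x j * (b j \<bullet> b i)))"
    by (simp add: inner_sum_left inner_sum_right sum_distrib_left)
  also have "\<dots> = (\<Sum>i\<in>?D. \<Sum>j\<in>?D. if i = j then (x i)\<^sup>2 else 0)"
    by (intro sum.cong refl) (auto simp: ort power2_eq_square)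
  also have "\<dots> = (\<Sum>i\<in>?D. (x i)\<^sup>2)"
    by simp
  finally show ?thesis
    by (simp add: norm_eq_sqrt_inner L2_set_def)
qed

lemma uniform_sphere_coord:
  "(uniform_sphere :: 'a measure) =
     distr (uniform_sphere_coord DIM('a)) borel (\<lambda>x. \<Sum>i<DIM('a). x i *\<^sub>R b i)"
proof (rule measure_eqI)
  let ?D = "{..<DIM('a)}"
  let ?L = "\<Pi>\<^sub>M i\<in>?D. (lborel::real measure)"
  let ?e = "\<lambda>x::nat \<Rightarrow> real. \<Sum>i\<in>?D. x i *\<^sub>R b i"
  let ?B = "{x \<in> ?D \<rightarrow>\<^sub>E UNIV. L2_set x ?D \<le> 1}"
  let ?n = "\<lambda>x::'a. x /\<^sub>R norm x"
  let ?m = "\<lambda>x. \<lambda>i\<in>?D. x i / L2_set x ?D"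
  show "sets (uniform_sphere :: 'a measure) = sets (distr (uniform_sphere_coord DIM('a)) borel ?e)"
    by (simp add: uniform_sphere_def)
  have e[measurable]: "?e \<in> ?L \<rightarrow>\<^sub>M borel"
    by measurable
  have e'[measurable]: "?e \<in> (\<Pi>\<^sub>M i\<in>?D. borel) \<rightarrow>\<^sub>M borel"
    by measurable
  have L2[measurable]: "(\<lambda>x. L2_set x ?D) \<in> borel_measurable ?L"
    unfolding L2_set_def by measurable
  have m[measurable]: "?m \<in> ?L \<rightarrow>\<^sub>M (\<Pi>\<^sub>M i\<in>?D. borel)"
    by measurable
  have n[measurable]: "?n \<in> borel \<rightarrow>\<^sub>M borel"
    by measurable
  have B: "?B \<in> sets ?L"
  proof -
    have "?B = {x \<in> space ?L. L2_set x ?D \<le> 1}"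
      by (simp add: space_PiM)
    then show ?thesis
      by simp
  qed
  have C: "cball 0 1 \<in> sets (lborel :: 'a measure)"
    by simp
  have eB: "?e -` cball 0 1 \<inter> space ?L = ?B"
  proof (rule set_eqI)
    fix x :: "nat \<Rightarrow> real"
    have "?e x \<in> cball 0 1 \<longleftrightarrow> L2_set x ?D \<le> 1"
      by (simp only: mem_cball dist_0_norm norm_coord)
    then show "x \<in> ?e -` cball 0 1 \<inter> space ?L \<longleftrightarrow> x \<in> ?B"
      by (simp add: space_PiM conj_commute)
  qed
  have em: "?e (?m x) = ?n (?e x)" for x
  proof -
    have "?e (?m x) = (\<Sum>i\<in>?D. inverse (L2_set x ?D) *\<^sub>R (x i *\<^sub>R b i))"
      by (intro sum.cong refl) (simp add: divide_inverse mult.commute)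
    then show ?thesis
      by (simp only: norm_coord scaleR_sum_right)
  qed
  fix A assume "A \<in> sets (uniform_sphere :: 'a measure)"
  then have A[measurable]: "A \<in> sets borel"
    by (simp add: uniform_sphere_def)
  have nA: "?n -` A \<in> sets (lborel :: 'a measure)"
    using measurable_sets[OF n A] by simp
  have mA: "(\<lambda>x. ?e (?m x)) -` A \<inter> space ?L \<in> sets ?L"
    by (rule measurable_sets[OF _ A]) (rule measurable_compose[OF m e'])
  have l: "emeasure lborel S = emeasure ?L (?e -` S \<inter> space ?L)" if "S \<in> sets borel" for S :: "'a set"
    by (subst lborel_coord) (rule emeasure_distr[OF e that])
  have "emeasure (uniform_sphere :: 'a measure) A = emeasure (uniform_measure lborel (cball 0 1)) (?n -` A)"
    unfolding uniform_sphere_def by (subst emeasure_distr) auto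
  also have "\<dots> = emeasure lborel (cball 0 1 \<inter> ?n -` A) / emeasure lborel (cball (0::'a) 1)"
    by (rule emeasure_uniform_measure[OF C nA])
  also have "\<dots> = emeasure ?L (?B \<inter> ((\<lambda>x. ?e (?m x)) -` A \<inter> space ?L)) / emeasure ?L ?B"
  proof -
    have 1: "?e -` (cball 0 1 \<inter> ?n -` A) \<inter> space ?L = ?B \<inter> ((\<lambda>x. ?e (?m x)) -` A \<inter> space ?L)"
      unfolding eB[symmetric] em by auto
    have 2: "cball 0 1 \<inter> ?n -` A \<in> sets borel"
      using C nA by simp
    show ?thesis
      by (subst l[OF 2], subst l) (simp_all only: 1 eB, simp)
  qed
  also have "\<dots> = emeasure (uniform_measure ?L ?B) ((\<lambda>x. ?e (?m x)) -` A \<inter> space ?L)"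
    by (rule emeasure_uniform_measure[OF B mA, symmetric])
  also have "\<dots> = emeasure (distr (uniform_sphere_coord DIM('a)) borel ?e) A"
  proof -
    have m': "?m \<in> uniform_measure ?L ?B \<rightarrow>\<^sub>M (\<Pi>\<^sub>M i\<in>?D. borel)"
      using m by (simp add: measurable_def)
    have "distr (uniform_sphere_coord DIM('a)) borel ?e = distr (uniform_measure ?L ?B) borel (?e \<circ> ?m)"
      unfolding uniform_sphere_coord_def by (rule distr_distr[OF e' m'])
    moreover have "?e \<circ> ?m \<in> uniform_measure ?L ?B \<rightarrow>\<^sub>M borel"
      by (rule measurable_comp[OF m' e'])
    ultimately show ?thesis
      using A by (simp only: emeasure_distr) (simp add: comp_def)
  qed
  finally show "emeasure (uniform_sphere :: 'a measure) A
      = emeasure (distr (uniform_sphere_coord DIM('a)) borel ?e) A" .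
qed

end

lemma sphere_moment_constantD:
  fixes h :: "'a::euclidean_space \<Rightarrow> real"
  assumes c: "sphere_moment_constant c" and M: "M > 0" and h: "M-lipschitz_on UNIV h"
  shows "sqrt (\<integral>u. (h u - (\<integral>v. h v \<partial>uniform_sphere)) ^ 4 \<partial>uniform_sphere) \<le> c * M\<^sup>2 / real DIM('a)"
proof -
  let ?D = "{..<DIM('a)}"
  obtain b :: "nat \<Rightarrow> 'a" where b: "bij_betw b ?D Basis"
    using ex_bij_betw_nat_finite[OF finite_Basis] by (auto simp: atLeast0LessThan)
  let ?e = "\<lambda>x::nat \<Rightarrow> real. \<Sum>i\<in>?D. x i *\<^sub>R b i"
  let ?U = "uniform_sphere_coord DIM('a)"
  have e: "?e \<in> ?U \<rightarrow>\<^sub>M borel"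
  proof -
    have "?e \<in> (\<Pi>\<^sub>M i\<in>?D. borel) \<rightarrow>\<^sub>M borel"
      by measurable
    then show ?thesis
      by (simp add: uniform_sphere_coord_def)
  qed
  have [measurable]: "h \<in> borel_measurable borel"
    using h by (intro borel_measurable_continuous_onI lipschitz_on_continuous_on)
  have tr: "(\<integral>u. g u \<partial>uniform_sphere) = (\<integral>x. g (?e x) \<partial>?U)"
    if "g \<in> borel_measurable borel" for g :: "'a \<Rightarrow> real"
    unfolding uniform_sphere_coord[OF b] by (rule integral_distr[OF e that])
  have lip: "\<bar>h (?e x) - h (?e y)\<bar> \<le> M * L2_set (\<lambda>i. x i - y i) ?D" for x y
  proof -
    have "\<bar>h (?e x) - h (?e y)\<bar> \<le> M * norm (?e x - ?e y)"
      using lipschitz_onD[OF h, of "?e x" "?e y"] by (simp add: dist_norm)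
    also have "?e x - ?e y = ?e (\<lambda>i. x i - y i)"
      by (simp add: sum_subtractf scaleR_diff_left)
    finally show ?thesis
      by (simp only: norm_coord[OF b])
  qed
  have "DIM('a) \<ge> 1"
    using DIM_positive[where 'a='a] by simp
  then have "sqrt (\<integral>x. (h (?e x) - (\<integral>y. h (?e y) \<partial>?U)) ^ 4 \<partial>?U) \<le> c * M\<^sup>2 / real DIM('a)"
    using c[unfolded sphere_moment_constant_def, rule_format, OF _ M, of "DIM('a)" "\<lambda>x. h (?e x)"] lip
    by simp
  then show ?thesis
    by (simp add: tr)
qed

end

theory Submission
  imports Defs
begin

text \<open>
  Write \<open>g\<^sub>t = (d / \<alpha>) D\<^sub>t u\<^sub>t\<close> with the residual \<open>D\<^sub>t\<close>, the difference of two consecutive observations.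
  Expanding \<open>\<parallel>x\<^sub>t\<^sub>+\<^sub>1 - y\<parallel>\<^sup>2 = \<parallel>x\<^sub>t - y\<parallel>\<^sup>2 - 2 \<eta> g\<^sub>t \<bullet> (x\<^sub>t - y) + \<eta>\<^sup>2 \<parallel>g\<^sub>t\<parallel>\<^sup>2\<close> with \<open>y\<close> the minimizer and
  summing over \<open>t\<close> reduces the theorem to two estimates, which hold for every \<open>y\<close>.

  First, \<open>E[g\<^sub>t \<bullet> (x\<^sub>t - y)] \<ge> E[F(x\<^sub>t)] - F(y) - L\<^sub>0 \<alpha>\<close>. Given the past, the mean of \<open>g\<^sub>t\<close> is
  \<open>(d / \<alpha>) E[F(x\<^sub>t + \<alpha> u) u]\<close> with \<open>u\<close> uniform on the sphere, since the noise averages out and the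
  previous observation is multiplied by a direction of mean zero. The divergence theorem would
  identify this vector with the gradient of a ball average of \<open>F\<close>. A more elementary argument
  suffices. Put \<open>w = x\<^sub>t - y\<close> and pair every \<open>u\<close> with its mirror image \<open>u'\<close> in the hyperplane orthogonal
  to \<open>w\<close>. Then \<open>F(x\<^sub>t + \<alpha> u) - F(x\<^sub>t + \<alpha> u')\<close> is the increment of a convex function over a chord
  parallel to \<open>w\<close>, and its slope, times \<open>\<parallel>w\<parallel>\<close>, is at least the value of \<open>F\<close> at the midpoint of the chord
  minus \<open>F(y) + L\<^sub>0 \<alpha>\<close> (\<open>convex_secant_bound\<close>, \<open>reflection_secant_bound\<close>). The chords carry the
  weight \<open>(u \<bullet> w)\<^sup>2\<close>, of mean \<open>\<parallel>w\<parallel>\<^sup>2 / d\<close>, and averaging over \<open>\<plusminus>u\<close> moves the midpoint to \<open>x\<^sub>t\<close> by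
  convexity (\<open>sphere_estimator_subgradient\<close>).

  Second, \<open>E[D\<^sub>t\<^sup>2] \<le> 18 \<kappa>\<close> with \<open>\<kappa> = \<sigma>\<^sub>0\<^sup>2 + c\<^sub>0 L\<^sub>0\<^sup>2 \<alpha>\<^sup>2 / d\<close> (\<open>residual_moment\<close>). An observation is the
  mean of \<open>F\<close> over the sphere around the iterate, plus the deviation of \<open>F\<close> from this mean, plus noise.
  The constant \<open>c\<^sub>0\<close> bounds the variance of the deviation, \<open>\<sigma>\<^sub>0\<^sup>2\<close> that of the noise, and the sphere
  means at consecutive iterates differ by at most \<open>L\<^sub>0 \<parallel>x\<^sub>t - x\<^sub>t\<^sub>-\<^sub>1\<parallel>\<close>, a multiple of \<open>\<bar>D\<^sub>t\<^sub>-\<^sub>1\<bar>\<close>. The bound on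
  the step size turns this into a contracting recursion for \<open>E[D\<^sub>t\<^sup>2]\<close>.

  Both estimates integrate out the sample \<open>(u\<^sub>t, \<xi>\<^sub>t)\<close> while the state produced by earlier samples stays
  fixed, which is legitimate because the joint law of state and sample is a product
  (\<open>distr_state_sample\<close>). Together they give the bound with \<open>\<parallel>x\<^sub>1 - x\<^sup>*\<parallel>\<^sup>2 / (2 T \<eta>)\<close> and the constant \<open>9\<close>
  (\<open>average_gap\<close>).
\<close>

section \<open>The uniform distribution on the sphere\<close>

lemma borel_measurable_orthogonal:
  fixes R :: "'a::euclidean_space \<Rightarrow> 'a"
  assumes "orthogonal_transformation R"
  shows "R \<in> borel_measurable borel"
  using assms by (intro borel_measurable_continuous_onI linear_continuous_on)
    (simp add: orthogonal_transformation_linear linear_conv_bounded_linear[symmetric])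

text \<open>
  The image measure \<open>\<mu>\<close> is translation invariant because \<open>R\<close> is linear and onto, and it gives the
  unit ball \<open>B\<close> its Lebesgue measure. The rest is uniqueness of Haar measure: integrating
  \<open>1\<^sub>A(x) 1\<^sub>B(x + y)\<close> over \<open>x\<close> by \<open>\<mu>\<close> and over \<open>y\<close> by \<open>\<lambda>\<close> in both orders gives
  \<open>\<mu>(A) \<lambda>(B) = \<lambda>(A) \<mu>(B)\<close>.
\<close>
lemma lborel_distr_orthogonal:
  fixes R :: "'a::euclidean_space \<Rightarrow> 'a"
  assumes R: "orthogonal_transformation R"
  shows "distr lborel borel R = lborel"
proof (rule measure_eqI)
  fix A :: "'a set"
  assume "A \<in> sets (distr lborel borel R)"
  then have A[measurable]: "A \<in> sets borel" by simp
  let ?m = "distr lborel borel R" and ?B = "ball 0 1 :: 'a set"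
  have R_meas[measurable]: "R \<in> borel_measurable borel"
    by (rule borel_measurable_orthogonal[OF R])
  have lin: "linear R"
    by (rule orthogonal_transformation_linear[OF R])
  have "R -` ?B = ?B"
    by (auto simp: orthogonal_transformation_norm[OF R])
  then have mB: "emeasure ?m ?B = emeasure lborel ?B"
    by (subst emeasure_distr) auto
  have trans: "(\<integral>\<^sup>+x. f (x + y) \<partial>?m) = (\<integral>\<^sup>+x. f x \<partial>?m)"
    if [measurable]: "f \<in> borel_measurable borel" for f :: "'a \<Rightarrow> ennreal" and y
  proof -
    obtain z where z: "R z = y"
      using orthogonal_transformation_surj[OF R] by (metis surjD)
    have "(\<integral>\<^sup>+x. f (x + y) \<partial>?m) = (\<integral>\<^sup>+x. f (R (z + x)) \<partial>lborel)"
      by (subst nn_integral_distr) (simp_all add: linear_add[OF lin] z add.commute)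
    also have "\<dots> = (\<integral>\<^sup>+x. f (R x) \<partial>distr lborel borel ((+) z))"
      by (subst nn_integral_distr) simp_all
    also have "\<dots> = (\<integral>\<^sup>+x. f x \<partial>?m)"
      by (simp add: lborel_distr_plus nn_integral_distr)
    finally show ?thesis .
  qed
  interpret m: sigma_finite_measure ?m
  proof
    have vim: "R -` ball 0 r = ball 0 r" for r
      by (auto simp: orthogonal_transformation_norm[OF R])
    have "emeasure ?m (ball 0 (real n)) \<noteq> \<infinity>" for n
      by (subst emeasure_distr) (use emeasure_lborel_ball_finite in \<open>auto simp: vim less_top\<close>)
    moreover have "(\<Union>n. ball 0 (real n)) = (UNIV :: 'a set)"
      by (auto simp: reals_Archimedean2)
    ultimately show "\<exists>A. countable A \<and> A \<subseteq> sets ?m \<and> \<Union>A = space ?m \<and> (\<forall>a\<in>A. emeasure ?m a \<noteq> \<infinity>)"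
      by (intro exI[of _ "range (\<lambda>n. ball 0 (real n))"]) auto
  qed
  interpret P: pair_sigma_finite ?m "lborel :: 'a measure" ..
  have refl: "(\<integral>\<^sup>+y. indicator A (x - y) \<partial>lborel) = emeasure lborel A" for x :: 'a
  proof -
    have "lborel = distr lborel borel (\<lambda>y. x - y)"
      using lborel_affine[of "-1" x] by (simp add: density_1)
    then have "emeasure lborel A = (\<integral>\<^sup>+y. indicator A y \<partial>distr lborel borel (\<lambda>y. x - y))"
      by simp
    then show ?thesis
      by (simp add: nn_integral_distr del: nn_integral_indicator)
  qed
  have B_meas[measurable]: "(indicator ?B :: 'a \<Rightarrow> ennreal) \<in> borel_measurable borel"
    by (intro borel_measurable_indicator borel_open open_ball)
  have "emeasure ?m A * emeasure lborel ?B = (\<integral>\<^sup>+x. indicator A x * emeasure lborel ?B \<partial>?m)"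
    by (simp add: nn_integral_multc)
  also have "\<dots> = (\<integral>\<^sup>+x. (\<integral>\<^sup>+y. indicator A x * indicator ?B (x + y) \<partial>lborel) \<partial>?m)"
  proof (rule nn_integral_cong)
    fix x :: 'a
    have "emeasure lborel ?B = (\<integral>\<^sup>+y. indicator ?B y \<partial>distr lborel borel ((+) x))"
      by (simp add: lborel_distr_plus)
    also have "\<dots> = (\<integral>\<^sup>+y. indicator ?B (x + y) \<partial>lborel)"
      by (subst nn_integral_distr) simp_all
    finally show "indicator A x * emeasure lborel ?B = (\<integral>\<^sup>+y. indicator A x * indicator ?B (x + y) \<partial>lborel)"
      by (simp add: nn_integral_cmult)
  qed
  also have "\<dots> = (\<integral>\<^sup>+y. (\<integral>\<^sup>+x. indicator A x * indicator ?B (x + y) \<partial>?m) \<partial>lborel)"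
    by (rule P.Fubini'[symmetric]) (simp add: split_beta')
  also have "\<dots> = (\<integral>\<^sup>+y. (\<integral>\<^sup>+x. indicator A (x - y) * indicator ?B x \<partial>?m) \<partial>lborel)"
  proof (rule nn_integral_cong)
    fix y :: 'a
    show "(\<integral>\<^sup>+x. indicator A x * indicator ?B (x + y) \<partial>?m) = (\<integral>\<^sup>+x. indicator A (x - y) * indicator ?B x \<partial>?m)"
      using trans[of "\<lambda>x. indicator A (x - y) * indicator ?B x" y] by simp
  qed
  also have "\<dots> = (\<integral>\<^sup>+x. (\<integral>\<^sup>+y. indicator A (x - y) * indicator ?B x \<partial>lborel) \<partial>?m)"
    by (rule P.Fubini') (simp add: split_beta')
  also have "\<dots> = emeasure lborel A * emeasure ?m ?B"
    by (simp add: nn_integral_multc nn_integral_cmult refl)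
  finally have "emeasure ?m A * emeasure lborel ?B = emeasure lborel A * emeasure lborel ?B"
    by (simp only: mB)
  moreover have "emeasure lborel ?B \<noteq> 0"
    using unit_ball_vol_pos[of "real DIM('a)"] by (simp add: emeasure_ball del: unit_ball_vol_pos)
  moreover have "emeasure lborel ?B \<noteq> \<infinity>"
    using emeasure_lborel_ball_finite[of "0::'a" 1] by (simp add: less_top)
  ultimately show "emeasure ?m A = emeasure lborel A"
    by (metis ennreal_mult_cancel_left infinity_ennreal_def mult.commute)
qed simp

interpretation uniform_sphere: prob_space "uniform_sphere :: 'a::euclidean_space measure"
proof -
  have "prob_space (uniform_measure lborel (cball 0 1 :: 'a set))"
    using emeasure_lborel_cball_finite[of "0::'a" 1]
      unit_ball_vol_pos[of "real DIM('a)"]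
    by (intro prob_space_uniform_measure) (auto simp: emeasure_cball less_top simp del: unit_ball_vol_pos)
  then show "prob_space (uniform_sphere :: 'a measure)"
    unfolding uniform_sphere_def by (rule prob_space.prob_space_distr) simp
qed

lemma sets_uniform_sphere [measurable_cong, simp]: "sets uniform_sphere = sets borel"
  by (simp add: uniform_sphere_def)

lemma space_uniform_sphere [simp]: "space uniform_sphere = UNIV"
  by (simp add: uniform_sphere_def)

lemma AE_uniform_sphere_norm: "AE u in uniform_sphere. norm (u :: 'a::euclidean_space) = 1"
proof -
  have "AE x in lborel. x \<noteq> (0::'a)"
    by (rule AE_lborel_singleton)
  then have "AE x in uniform_measure lborel (cball 0 1). norm (x /\<^sub>R norm (x::'a)) = 1"
    by (intro AE_uniform_measureI) auto
  then show ?thesis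
    unfolding uniform_sphere_def by (subst AE_distr_iff) auto
qed

text \<open>
  A continuous function is bounded on the compact unit ball, and almost every \<open>u\<close> lies in it.
\<close>
lemma integrable_uniform_sphere:
  fixes g :: "'a::euclidean_space \<Rightarrow> real"
  assumes "continuous_on UNIV g"
  shows "integrable uniform_sphere g"
proof -
  have "compact (g ` cball 0 1)"
    using assms by (intro compact_continuous_image) (auto intro: continuous_on_subset)
  then obtain B where B: "norm (g u) \<le> B" if "norm u \<le> 1" for u
    by (metis compact_imp_bounded bounded_iff imageI mem_cball_0)
  show ?thesis
  proof (rule uniform_sphere.integrable_const_bound)
    show "AE u in uniform_sphere. norm (g u) \<le> B"
      using AE_uniform_sphere_norm by eventually_elim (rule B, simp)
    show "g \<in> borel_measurable uniform_sphere"
      by (subst measurable_cong_sets[OF sets_uniform_sphere refl])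
        (rule borel_measurable_continuous_onI[OF assms])
  qed
qed

text \<open>
  The unit ball is invariant under \<open>R\<close>, and radial projection commutes with \<open>R\<close>, so the invariance
  of Lebesgue measure passes to the sphere.
\<close>
lemma distr_uniform_sphere_orthogonal:
  fixes R :: "'a::euclidean_space \<Rightarrow> 'a"
  assumes R: "orthogonal_transformation R"
  shows "distr uniform_sphere borel R = uniform_sphere"
proof -
  let ?B = "cball 0 1 :: 'a set" and ?n = "\<lambda>x::'a. x /\<^sub>R norm x"
  let ?U = "uniform_measure lborel ?B"
  have R_meas[measurable]: "R \<in> borel_measurable borel"
    by (rule borel_measurable_orthogonal[OF R])
  have vim: "R -` ?B = ?B"
    by (auto simp: orthogonal_transformation_norm[OF R])
  have "distr ?U borel R = ?U"
  proof (rule measure_eqI)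
    fix A assume "A \<in> sets (distr ?U borel R)"
    then have A[measurable]: "A \<in> sets borel" by simp
    have "emeasure lborel (?B \<inter> R -` A) = emeasure (distr lborel borel R) (?B \<inter> A)"
      by (subst emeasure_distr) (auto simp: vim)
    then have *: "emeasure lborel (?B \<inter> R -` A) = emeasure lborel (?B \<inter> A)"
      by (simp only: lborel_distr_orthogonal[OF R])
    have "R -` A \<in> sets borel"
      using measurable_sets[OF R_meas A] by simp
    then show "emeasure (distr ?U borel R) A = emeasure ?U A"
      by (subst emeasure_distr) (simp_all add: *)
  qed simp
  moreover have "distr (distr ?U borel ?n) borel R = distr (distr ?U borel R) borel ?n"
    by (subst distr_distr, measurable, subst distr_distr, measurable)
      (simp add: comp_def orthogonal_transformation_norm[OF R] orthogonal_transformation_scaleR[OF R])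
  ultimately show ?thesis
    by (simp add: uniform_sphere_def)
qed

lemma integral_uniform_sphere_orthogonal:
  fixes R :: "'a::euclidean_space \<Rightarrow> 'a" and g :: "'a \<Rightarrow> real"
  assumes R: "orthogonal_transformation R" and g: "g \<in> borel_measurable borel"
  shows "(\<integral>u. g (R u) \<partial>uniform_sphere) = (\<integral>u. g u \<partial>uniform_sphere)"
  using integral_distr[of R uniform_sphere borel g] g borel_measurable_orthogonal[OF R]
  by (simp add: distr_uniform_sphere_orthogonal[OF R])

text \<open>
  Mirror image in the hyperplane orthogonal to \<open>w\<close>. For \<open>w = 0\<close> the division by zero makes this the
  identity, so it is orthogonal for every \<open>w\<close>.
\<close>
definition reflection :: "'a::euclidean_space \<Rightarrow> 'a \<Rightarrow> 'a" where
  "reflection w u = u - (2 * (u \<bullet> w) / (w \<bullet> w)) *\<^sub>R w"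

lemma orthogonal_reflection: "orthogonal_transformation (reflection w)"
proof (cases "w = 0")
  case False
  have "linear (reflection w)"
    by (rule linearI) (simp_all add: reflection_def algebra_simps inner_add_left add_divide_distrib)
  moreover have "reflection w u \<bullet> reflection w v = u \<bullet> v" for u v
    using False by (simp add: reflection_def inner_diff_left inner_diff_right field_simps inner_commute)
  ultimately show ?thesis
    by (simp add: orthogonal_transformation_def)
next
  case True
  then have "reflection w = (\<lambda>u. u)"
    by (simp add: reflection_def fun_eq_iff)
  then show ?thesis
    by simp
qed

lemma reflection_inner: "w \<noteq> 0 \<Longrightarrow> reflection w u \<bullet> w = - (u \<bullet> w)"
  by (simp add: reflection_def inner_diff_left)

text \<open>
  The reflection along \<open>a - b\<close> exchanges \<open>a\<close> and \<open>b\<close> if they have equal length, so the second moment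
  of \<open>u \<bullet> a\<close> depends on the length of \<open>a\<close> only. Over an orthonormal basis these moments add up to
  the mean of \<open>\<parallel>u\<parallel>\<^sup>2 = 1\<close>.
\<close>
lemma uniform_sphere_second_moment:
  fixes w :: "'a::euclidean_space"
  shows "(\<integral>u. (u \<bullet> w)\<^sup>2 \<partial>uniform_sphere) = (norm w)\<^sup>2 / DIM('a)"
proof -
  let ?I = "\<lambda>a::'a. \<integral>u. (u \<bullet> a)\<^sup>2 \<partial>uniform_sphere"
  have same: "?I a = ?I b" if ab: "norm a = norm b" for a b
  proof -
    have sq: "a \<bullet> a = b \<bullet> b"
      using ab by (simp add: dot_square_norm)
    have "reflection (a - b) u \<bullet> a = u \<bullet> b" for u
    proof (cases "a = b")
      case False
      then have nz: "(a - b) \<bullet> (a - b) \<noteq> 0" by simp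
      have two: "2 * ((a - b) \<bullet> a) = (a - b) \<bullet> (a - b)"
        by (simp add: inner_diff_left inner_diff_right sq inner_commute)
      have "reflection (a - b) u \<bullet> a
          = u \<bullet> a - (u \<bullet> (a - b)) * (2 * ((a - b) \<bullet> a)) / ((a - b) \<bullet> (a - b))"
        by (simp add: reflection_def inner_diff_left)
      then show ?thesis
        using nz by (simp only: two) (simp add: inner_diff_right)
    qed (simp add: reflection_def)
    then show ?thesis
      using integral_uniform_sphere_orthogonal[OF orthogonal_reflection[of "a - b"], of "\<lambda>u. (u \<bullet> a)\<^sup>2"]
      by simp
  qed
  have int: "integrable uniform_sphere (\<lambda>u. (u \<bullet> a)\<^sup>2)" for a :: 'a
    by (intro integrable_uniform_sphere continuous_intros)
  obtain e :: 'a where e: "e \<in> Basis"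
    using nonempty_Basis by blast
  have "?I b = ?I e" if "b \<in> Basis" for b
    by (rule same) (simp add: that e)
  then have "DIM('a) * ?I e = (\<Sum>b\<in>Basis. ?I b)"
    by simp
  also have "\<dots> = (\<integral>u. (\<Sum>b\<in>Basis. (u \<bullet> b)\<^sup>2) \<partial>(uniform_sphere :: 'a measure))"
    by (rule Bochner_Integration.integral_sum[symmetric]) (rule int)
  also have "\<dots> = (\<integral>u. 1 \<partial>(uniform_sphere :: 'a measure))"
  proof (rule integral_cong_AE)
    show "AE u::'a in uniform_sphere. (\<Sum>b\<in>Basis. (u \<bullet> b)\<^sup>2) = 1"
      using AE_uniform_sphere_norm
    proof eventually_elim
      case (elim u)
      have "(\<Sum>b\<in>Basis. (u \<bullet> b)\<^sup>2) = u \<bullet> u"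
        by (simp add: euclidean_inner[of u u] power2_eq_square)
      then show ?case
        using elim by (simp add: dot_square_norm)
    qed
  qed simp_all
  finally have "?I e = 1 / DIM('a)"
    using uniform_sphere.prob_space[where 'a='a] by (simp add: field_simps)
  moreover have "?I w = (norm w)\<^sup>2 * ?I e"
  proof -
    have "?I w = ?I (norm w *\<^sub>R e)"
      by (rule same) (simp add: e)
    then show ?thesis
      by (simp add: power_mult_distrib)
  qed
  ultimately show ?thesis
    by simp
qed

lemma uniform_sphere_mean_zero:
  "(\<integral>u. u \<bullet> w \<partial>uniform_sphere) = (0::real)" for w :: "'a::euclidean_space"
  using integral_uniform_sphere_orthogonal[of uminus "\<lambda>u. u \<bullet> w"]
  by (simp add: orthogonal_transformation_neg[of "\<lambda>u. u", simplified])

section \<open>The estimator is an approximate subgradient\<close>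

text \<open>
  The mean slope of \<open>\<phi>\<close> over \<open>[-h, h]\<close>, times a step of length \<open>w\<close>, is compared with the increment of
  \<open>\<phi>\<close> over that step. If \<open>w \<ge> h\<close>, then both ends of \<open>[-w, 0]\<close> lie to the left of those of \<open>[-h, h]\<close>
  and slopes of a convex function increase. A shorter step admits no such comparison of slopes;
  the claim then survives because \<open>C\<close> bounds \<open>\<phi>\<close> on the whole window \<open>[-h - w, h - w]\<close>, which
  contains \<open>0\<close> and \<open>-h\<close>. Indeed the left-hand side is then at most \<open>0\<close>, which settles a nonnegative
  slope, and if \<open>\<phi>\<close> drops from \<open>-h\<close> to \<open>h\<close>, then by convexity half of this drop has already occurred
  at \<open>0\<close>, while the right-hand side loses only the fraction \<open>w / h\<close> of that half.
\<close>
lemma convex_secant_bound: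
  fixes \<phi> :: "real \<Rightarrow> real"
  assumes conv: "convex_on UNIV \<phi>" and h: "h > 0" and w: "w > 0"
    and C: "\<And>\<tau>. \<bar>\<tau>\<bar> \<le> h \<Longrightarrow> \<phi> (\<tau> - w) \<le> C"
  shows "\<phi> 0 - C \<le> w * ((\<phi> h - \<phi> (- h)) / (2 * h))"
proof (cases "w < h")
  case True
  have mid: "\<phi> 0 \<le> (\<phi> h + \<phi> (- h)) / 2"
    using convex_onD[OF conv, of "1/2" h "-h"] by (simp add: field_simps)
  have "\<phi> 0 \<le> C" "\<phi> (- h) \<le> C"
    using C[of w] C[of "w - h"] True w by auto
  then show ?thesis
  proof (cases "\<phi> h \<ge> \<phi> (- h)")
    case True
    then have "0 \<le> w * ((\<phi> h - \<phi> (- h)) / (2 * h))"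
      using w h by simp
    then show ?thesis
      using \<open>\<phi> 0 \<le> C\<close> by linarith
  next
    case False
    then have "w * (\<phi> (- h) - \<phi> h) \<le> h * (\<phi> (- h) - \<phi> h)"
      using True by (intro mult_right_mono) auto
    then have "w * ((\<phi> (- h) - \<phi> h) / (2 * h)) \<le> (\<phi> (- h) - \<phi> h) / 2"
      using h by (simp add: field_simps)
    moreover have "w * ((\<phi> h - \<phi> (- h)) / (2 * h)) = - (w * ((\<phi> (- h) - \<phi> h) / (2 * h)))"
      by (simp add: diff_divide_distrib algebra_simps)
    ultimately show ?thesis
      using mid \<open>\<phi> (- h) \<le> C\<close> by argo
  qed
next
  case False
  have "(\<phi> (- w) - \<phi> 0) / (- w - 0) \<le> (\<phi> (- h) - \<phi> 0) / (- h - 0)"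
  proof (cases "w = h")
    case False
    then show ?thesis
      using convex_on_slope_le(2)[OF conv, of "- w" 0 "- h"] \<open>\<not> w < h\<close> h by simp
  qed simp
  also have "\<dots> \<le> (\<phi> (- h) - \<phi> h) / (- h - h)"
    using convex_on_slope_le(1)[OF conv, of "- h" h 0] h by simp
  finally have "(\<phi> 0 - \<phi> (- w)) / w \<le> (\<phi> h - \<phi> (- h)) / (2 * h)"
    by (simp add: diff_divide_distrib mult.commute)
  then have "\<phi> 0 - \<phi> (- w) \<le> w * ((\<phi> h - \<phi> (- h)) / (2 * h))"
    using w by (simp add: pos_divide_le_eq mult.commute)
  then show ?thesis
    using C[of 0] h by simp
qed

text \<open>
  The points \<open>x + \<alpha> u\<close> and \<open>x + \<alpha> u'\<close>, with \<open>u'\<close> the mirror image of \<open>u\<close>, are the ends of a chord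
  parallel to \<open>w\<close>. Its midpoint is \<open>x + \<alpha> z\<close>, with \<open>z\<close> the projection of \<open>u\<close> onto the hyperplane, and
  its half-length is \<open>\<alpha> \<bar>s\<bar>\<close>, with \<open>s\<close> the component of \<open>u\<close> along \<open>w\<close>. The secant bound applies to \<open>F\<close>
  along the chord: shifted by \<open>-w\<close>, the chord stays within \<open>\<alpha>\<close> of \<open>x - w\<close>, where \<open>F\<close> is at most
  \<open>F (x - w) + L \<alpha>\<close>.
\<close>
lemma reflection_secant_bound:
  fixes F :: "'a::euclidean_space \<Rightarrow> real"
  assumes conv: "convex_on UNIV F" and lip: "L-lipschitz_on UNIV F"
    and \<alpha>: "\<alpha> > 0" and u: "norm u = 1" and w: "w \<noteq> 0"
  shows "2 * \<alpha> * (u \<bullet> w)\<^sup>2 / (norm w)\<^sup>2 *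
      (F (x + \<alpha> *\<^sub>R (u - ((u \<bullet> w) / (w \<bullet> w)) *\<^sub>R w)) - F (x - w) - L * \<alpha>)
    \<le> (u \<bullet> w) * (F (x + \<alpha> *\<^sub>R u) - F (x + \<alpha> *\<^sub>R reflection w u))"
proof (cases "u \<bullet> w = 0")
  case False
  define W s z e \<phi> where "W = norm w" and "s = (u \<bullet> w) / norm w"
    and "z = u - ((u \<bullet> w) / (w \<bullet> w)) *\<^sub>R w" and "e = w /\<^sub>R norm w"
    and "\<phi> = (\<lambda>\<tau>. F (x + \<alpha> *\<^sub>R z + \<tau> *\<^sub>R e))"
  define C where "C = F (x - w) + L * \<alpha>"
  have W: "W > 0" "w = W *\<^sub>R e" "norm e = 1" "e \<bullet> e = 1"
    using w by (simp_all add: W_def e_def dot_square_norm)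
  have uw: "u \<bullet> w = s * W" and s0: "s \<noteq> 0"
    using w False by (simp_all add: W_def s_def)
  have ww: "w \<bullet> w = W\<^sup>2"
    by (simp add: W_def dot_square_norm)
  have z: "u = z + s *\<^sub>R e"
    using W(1) by (simp add: z_def uw ww W(2)[symmetric]) (simp add: W(2) power2_eq_square)
  have ru: "reflection w u = z - s *\<^sub>R e"
    using W(1) by (simp add: reflection_def z_def uw ww) (simp add: W(2) power2_eq_square algebra_simps flip: scaleR_add_left)
  have ue: "u \<bullet> e = s"
    using uw W by (simp add: W(2))
  then have ze: "z \<bullet> e = 0"
    using z W(4) by (metis add_cancel_left_left inner_add_left inner_scaleR_left mult.right_neutral)
  have pyth: "(norm (z + \<tau> *\<^sub>R e))\<^sup>2 = (norm z)\<^sup>2 + \<tau>\<^sup>2" for \<tau>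
    using ze W(4) unfolding power2_norm_eq_inner
    by (simp add: inner_add_left inner_add_right inner_commute[of e z] power2_eq_square)
  have conv\<phi>: "convex_on UNIV \<phi>"
  proof (rule convex_onI)
    fix t a b :: real assume t: "0 < t" "t < 1"
    have "F ((1 - t) *\<^sub>R (x + \<alpha> *\<^sub>R z + a *\<^sub>R e) + t *\<^sub>R (x + \<alpha> *\<^sub>R z + b *\<^sub>R e))
       \<le> (1 - t) * F (x + \<alpha> *\<^sub>R z + a *\<^sub>R e) + t * F (x + \<alpha> *\<^sub>R z + b *\<^sub>R e)"
      using t by (intro convex_onD[OF conv]) auto
    also have "(1 - t) *\<^sub>R (x + \<alpha> *\<^sub>R z + a *\<^sub>R e) + t *\<^sub>R (x + \<alpha> *\<^sub>R z + b *\<^sub>R e)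
       = x + \<alpha> *\<^sub>R z + ((1 - t) *\<^sub>R a + t *\<^sub>R b) *\<^sub>R e"
      by (simp add: algebra_simps)
    finally show "\<phi> ((1 - t) *\<^sub>R a + t *\<^sub>R b) \<le> (1 - t) * \<phi> a + t * \<phi> b"
      by (simp add: \<phi>_def)
  qed simp
  have bound: "\<phi> (\<tau> - W) \<le> C" if \<tau>: "\<bar>\<tau>\<bar> \<le> \<alpha> * \<bar>s\<bar>" for \<tau>
  proof -
    have "\<bar>\<tau> / \<alpha>\<bar> \<le> \<bar>s\<bar>"
      using \<tau> \<alpha> by (simp add: pos_divide_le_eq mult.commute)
    then have "(norm (z + (\<tau> / \<alpha>) *\<^sub>R e))\<^sup>2 \<le> (norm (z + s *\<^sub>R e))\<^sup>2"
      unfolding pyth by (simp only: abs_le_square_iff add_le_cancel_left)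
    then have n: "norm (z + (\<tau> / \<alpha>) *\<^sub>R e) \<le> 1"
      using u by (simp add: z[symmetric] abs_square_le_1)
    have "x + \<alpha> *\<^sub>R z + (\<tau> - W) *\<^sub>R e - (x - w) = \<alpha> *\<^sub>R (z + (\<tau> / \<alpha>) *\<^sub>R e)"
      using \<alpha> by (simp add: algebra_simps W(2)[symmetric])
    then have "norm (x + \<alpha> *\<^sub>R z + (\<tau> - W) *\<^sub>R e - (x - w)) \<le> \<alpha>"
      using n \<alpha> by simp
    then have "L * dist (x + \<alpha> *\<^sub>R z + (\<tau> - W) *\<^sub>R e) (x - w) \<le> L * \<alpha>"
      using lipschitz_on_nonneg[OF lip] by (intro mult_left_mono) (simp_all add: dist_norm)
    moreover have "\<bar>\<phi> (\<tau> - W) - F (x - w)\<bar> \<le> L * dist (x + \<alpha> *\<^sub>R z + (\<tau> - W) *\<^sub>R e) (x - w)"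
      using lipschitz_onD[OF lip, of "x + \<alpha> *\<^sub>R z + (\<tau> - W) *\<^sub>R e" "x - w"]
      by (simp add: \<phi>_def dist_real_def)
    ultimately show ?thesis
      by (simp add: C_def)
  qed
  have "\<phi> 0 - C \<le> W * ((\<phi> (\<alpha> * \<bar>s\<bar>) - \<phi> (- (\<alpha> * \<bar>s\<bar>))) / (2 * (\<alpha> * \<bar>s\<bar>)))"
    using bound \<alpha> s0 W(1) by (intro convex_secant_bound[OF conv\<phi>]) auto
  \<comment> \<open>The slope does not depend on which end of the chord is called \<open>u\<close>.\<close>
  also have "\<dots> = W * ((\<phi> (\<alpha> * s) - \<phi> (- (\<alpha> * s))) / (2 * (\<alpha> * s)))"
    by (cases "s \<ge> 0") (simp_all add: diff_divide_distrib)
  also have "\<phi> (\<alpha> * s) = F (x + \<alpha> *\<^sub>R u)"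
    by (simp add: \<phi>_def z scaleR_add_right add.assoc)
  also have "\<phi> (- (\<alpha> * s)) = F (x + \<alpha> *\<^sub>R reflection w u)"
    by (simp add: \<phi>_def ru scaleR_diff_right add.assoc)
  finally have "2 * \<alpha> * s\<^sup>2 * (\<phi> 0 - C)
      \<le> 2 * \<alpha> * s\<^sup>2 * (W * ((F (x + \<alpha> *\<^sub>R u) - F (x + \<alpha> *\<^sub>R reflection w u)) / (2 * (\<alpha> * s))))"
    using \<alpha> by (intro mult_left_mono) auto
  also have "\<dots> = (u \<bullet> w) * (F (x + \<alpha> *\<^sub>R u) - F (x + \<alpha> *\<^sub>R reflection w u))"
    using \<alpha> s0 by (simp add: uw power2_eq_square)
  finally have "2 * \<alpha> * s\<^sup>2 * (F (x + \<alpha> *\<^sub>R z) - F (x - w) - L * \<alpha>)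
      \<le> (u \<bullet> w) * (F (x + \<alpha> *\<^sub>R u) - F (x + \<alpha> *\<^sub>R reflection w u))"
    by (simp add: \<phi>_def C_def diff_diff_eq)
  moreover have "2 * \<alpha> * (u \<bullet> w)\<^sup>2 / (norm w)\<^sup>2 = 2 * \<alpha> * s\<^sup>2"
    using W(1) by (simp add: uw W_def[symmetric] power_mult_distrib)
  ultimately show ?thesis
    by (simp only: z_def)
qed simp

text \<open>
  By symmetry of the sphere the integrand \<open>q\<close> may be averaged over \<open>u\<close>, its mirror image, and the
  negatives of both. The first pair and the second pair satisfy the chord bound at midpoints
  \<open>x + \<alpha> z\<close> and \<open>x - \<alpha> z\<close>, and convexity replaces the mean of \<open>F\<close> at these midpoints by \<open>F x\<close>. What
  remains is the increment \<open>F x - F y - L \<alpha>\<close> with weight \<open>(u \<bullet> w)\<^sup>2\<close>, whose mean is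
  \<open>\<parallel>w\<parallel>\<^sup>2 / d\<close>.
\<close>
lemma sphere_estimator_subgradient:
  fixes F :: "'a::euclidean_space \<Rightarrow> real"
  assumes conv: "convex_on UNIV F" and lip: "L-lipschitz_on UNIV F" and \<alpha>: "\<alpha> > 0"
  shows "F x - F y - L * \<alpha> \<le> DIM('a) / \<alpha> * (\<integral>u. F (x + \<alpha> *\<^sub>R u) * (u \<bullet> (x - y)) \<partial>uniform_sphere)"
proof (cases "x = y")
  case True
  then show ?thesis
    using lipschitz_on_nonneg[OF lip] \<alpha> by simp
next
  case False
  define w where "w = x - y"
  have w: "w \<noteq> 0" using False by (simp add: w_def)
  let ?R = "reflection w"
  let ?q = "\<lambda>u. F (x + \<alpha> *\<^sub>R u) * (u \<bullet> w)"
  have cont: "continuous_on S F" for S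
    using lipschitz_on_continuous_on[OF lip] continuous_on_subset by blast
  have contq: "continuous_on UNIV ?q"
    by (intro continuous_intros continuous_on_compose2[OF cont]) auto
  have q: "?q \<in> borel_measurable borel"
    by (rule borel_measurable_continuous_onI[OF contq])
  have neg: "orthogonal_transformation (\<lambda>u::'a. - u)"
    by (simp add: orthogonal_transformation_neg)
  have negR: "orthogonal_transformation (\<lambda>u. - ?R u)"
    by (simp add: orthogonal_transformation_neg orthogonal_reflection)
  have contR: "continuous_on UNIV ?R"
    by (intro linear_continuous_on) (simp add: orthogonal_reflection orthogonal_transformation_linear flip: linear_conv_bounded_linear)
  have intR: "integrable uniform_sphere (\<lambda>u. ?q (T u))" if "T = (\<lambda>u. u) \<or> T = uminus \<or> T = ?R \<or> T = (\<lambda>u. - ?R u)" for T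
    using that contR by (intro integrable_uniform_sphere continuous_on_compose2[OF contq]) (auto intro!: continuous_intros)
  \<comment> \<open>The chord bounds at \<open>u\<close> and \<open>-u\<close> add up to \<open>c (u \<bullet> w)\<^sup>2\<close>.\<close>
  define c where "c = 4 * \<alpha> / (norm w)\<^sup>2 * (F x - F y - L * \<alpha>)"
  have "c * ((norm w)\<^sup>2 / DIM('a)) = (\<integral>u. c * (u \<bullet> w)\<^sup>2 \<partial>uniform_sphere)"
    by (simp add: uniform_sphere_second_moment)
  also have "\<dots> \<le> (\<integral>u. ?q u + ?q (?R u) + ?q (- u) + ?q (- ?R u) \<partial>uniform_sphere)"
  proof (rule integral_mono_AE)
    show "integrable uniform_sphere (\<lambda>u. c * (u \<bullet> w)\<^sup>2)"
      by (intro integrable_uniform_sphere continuous_intros)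
    show "integrable uniform_sphere (\<lambda>u. ?q u + ?q (?R u) + ?q (- u) + ?q (- ?R u))"
      using intR[of "\<lambda>u. u"] intR[of ?R] intR[of uminus] intR[of "\<lambda>u. - ?R u"] by simp
    show "AE u in uniform_sphere. c * (u \<bullet> w)\<^sup>2 \<le> ?q u + ?q (?R u) + ?q (- u) + ?q (- ?R u)"
      using AE_uniform_sphere_norm
    proof eventually_elim
      case (elim u)
      define z where "z = u - ((u \<bullet> w) / (w \<bullet> w)) *\<^sub>R w"
      define k where "k = 2 * \<alpha> * (u \<bullet> w)\<^sup>2 / (norm w)\<^sup>2"
      have Rm: "?R (- u) = - ?R u"
        by (simp add: reflection_def)
      have "k * (F (x + \<alpha> *\<^sub>R z) - F (x - w) - L * \<alpha>) \<le> (u \<bullet> w) * (F (x + \<alpha> *\<^sub>R u) - F (x + \<alpha> *\<^sub>R ?R u))"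
        using reflection_secant_bound[OF conv lip \<alpha> elim w, of x] by (simp only: z_def k_def)
      moreover have "k * (F (x - \<alpha> *\<^sub>R z) - F (x - w) - L * \<alpha>) \<le> - (u \<bullet> w) * (F (x - \<alpha> *\<^sub>R u) - F (x - \<alpha> *\<^sub>R ?R u))"
      proof -
        have "- u - ((- u \<bullet> w) / (w \<bullet> w)) *\<^sub>R w = - z"
          by (simp add: z_def)
        then show ?thesis
          using reflection_secant_bound[OF conv lip \<alpha> _ w, of "- u" x] elim by (simp add: k_def Rm)
      qed
      moreover have "k * (2 * F x) \<le> k * (F (x + \<alpha> *\<^sub>R z) + F (x - \<alpha> *\<^sub>R z))"
      proof (rule mult_left_mono)
        have "F ((1 - 1/2) *\<^sub>R (x + \<alpha> *\<^sub>R z) + (1/2) *\<^sub>R (x - \<alpha> *\<^sub>R z))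
            \<le> (1 - 1/2) * F (x + \<alpha> *\<^sub>R z) + (1/2) * F (x - \<alpha> *\<^sub>R z)"
          by (intro convex_onD[OF conv]) auto
        also have "(1 - 1/2) *\<^sub>R (x + \<alpha> *\<^sub>R z) + (1/2) *\<^sub>R (x - \<alpha> *\<^sub>R z) = x"
          by (simp add: algebra_simps flip: scaleR_add_left)
        finally show "2 * F x \<le> F (x + \<alpha> *\<^sub>R z) + F (x - \<alpha> *\<^sub>R z)"
          by simp
        show "k \<ge> 0"
          using \<alpha> by (simp add: k_def)
      qed
      moreover have "c * (u \<bullet> w)\<^sup>2 = k * (2 * F x) - 2 * (k * (F (x - w) + L * \<alpha>))"
        unfolding c_def k_def by (simp add: w_def diff_divide_distrib algebra_simps)
      ultimately show ?case
        using w by (simp add: reflection_inner algebra_simps)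
    qed
  qed
  also have "\<dots> = 4 * (\<integral>u. ?q u \<partial>uniform_sphere)"
    using intR[of "\<lambda>u. u"] intR[of ?R] intR[of uminus] intR[of "\<lambda>u. - ?R u"]
      integral_uniform_sphere_orthogonal[OF orthogonal_reflection[of w] q]
      integral_uniform_sphere_orthogonal[OF neg q] integral_uniform_sphere_orthogonal[OF negR q]
    by simp
  finally have "c * (norm w)\<^sup>2 / (4 * \<alpha>) \<le> DIM('a) / \<alpha> * (\<integral>u. ?q u \<partial>uniform_sphere)"
    using \<alpha> by (simp add: field_simps)
  moreover have "c * (norm w)\<^sup>2 / (4 * \<alpha>) = F x - F y - L * \<alpha>"
    using w \<alpha> by (simp add: c_def)
  ultimately show ?thesis
    by (simp add: w_def)
qed

section \<open>Each sample is independent of the past\<close>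

text \<open>
  A joint event of the components is turned into one event of the restricted family, because the
  independence hypothesis speaks of the two families as wholes.
\<close>
lemma cylinder_vimage:
  assumes W: "\<And>i. i \<in> I \<Longrightarrow> W i \<in> measurable M (C i)" and J: "J \<noteq> {}" "J \<subseteq> I"
  shows "(\<Inter>j\<in>J. W j -` c j \<inter> space M) =
    (\<lambda>\<omega>. \<lambda>i\<in>I. W i \<omega>) -` (\<Inter>j\<in>J. (\<lambda>f. f j) -` c j \<inter> space (PiM I C)) \<inter> space M"
proof -
  have "(\<lambda>i\<in>I. W i \<omega>) \<in> space (PiM I C)" if "\<omega> \<in> space M" for \<omega>
    using measurable_space[OF W that] by (auto simp: space_PiM)
  moreover have "(\<lambda>i\<in>I. W i \<omega>) j = W j \<omega>" if "j \<in> J" for j \<omega>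
    using that J by auto
  ultimately show ?thesis
    using J(1) by (intro set_eqI) (simp, blast)
qed

lemma cylinder_sets:
  assumes J: "finite J" "J \<noteq> {}" "J \<subseteq> I" and c: "\<And>j. j \<in> J \<Longrightarrow> c j \<in> sets (C j)"
  shows "(\<Inter>j\<in>J. (\<lambda>f. f j) -` c j \<inter> space (PiM I C)) \<in> sets (PiM I C)"
proof (rule sets.finite_INT)
  fix j assume j: "j \<in> J"
  then have "(\<lambda>f. f j) \<in> measurable (PiM I C) (C j)"
    using J by (intro measurable_component_singleton) auto
  then show "(\<lambda>f. f j) -` c j \<inter> space (PiM I C) \<in> sets (PiM I C)"
    using c[OF j] by (rule measurable_sets)
qed (use J in auto)

context prob_space
begin

lemma indep_rv_prob:
  assumes "indep_rv M A X B Y" "P \<in> sets A" "Q \<in> sets B"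
  shows "prob ((X -` P \<inter> space M) \<inter> (Y -` Q \<inter> space M)) =
    prob (X -` P \<inter> space M) * prob (Y -` Q \<inter> space M)"
proof (rule indep_setD)
  show "indep_set {X -` S \<inter> space M | S. S \<in> sets A} {Y -` S \<inter> space M | S. S \<in> sets B}"
    using assms(1) by (simp only: indep_rv_def)
qed (use assms(2,3) in blast)+

lemma indep_rv_family_prob:
  assumes indep: "indep_rv M (PiM I A) (\<lambda>\<omega>. \<lambda>i\<in>I. U i \<omega>) (PiM I B) (\<lambda>\<omega>. \<lambda>i\<in>I. V i \<omega>)"
    and J: "finite J" "J \<noteq> {}" "J \<subseteq> I"
    and U: "\<And>i. i \<in> I \<Longrightarrow> U i \<in> measurable M (A i)"
    and V: "\<And>i. i \<in> I \<Longrightarrow> V i \<in> measurable M (B i)"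
    and a: "\<And>j. j \<in> J \<Longrightarrow> a j \<in> sets (A j)" and b: "\<And>j. j \<in> J \<Longrightarrow> b j \<in> sets (B j)"
  shows "prob ((\<Inter>j\<in>J. U j -` a j \<inter> space M) \<inter> (\<Inter>j\<in>J. V j -` b j \<inter> space M)) =
    prob (\<Inter>j\<in>J. U j -` a j \<inter> space M) * prob (\<Inter>j\<in>J. V j -` b j \<inter> space M)"
proof -
  have "(\<Inter>j\<in>J. U j -` a j \<inter> space M) =
      (\<lambda>\<omega>. \<lambda>i\<in>I. U i \<omega>) -` (\<Inter>j\<in>J. (\<lambda>f. f j) -` a j \<inter> space (PiM I A)) \<inter> space M"
    by (rule cylinder_vimage[OF U J(2,3)])
  moreover have "(\<Inter>j\<in>J. V j -` b j \<inter> space M) =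
      (\<lambda>\<omega>. \<lambda>i\<in>I. V i \<omega>) -` (\<Inter>j\<in>J. (\<lambda>f. f j) -` b j \<inter> space (PiM I B)) \<inter> space M"
    by (rule cylinder_vimage[OF V J(2,3)])
  moreover have "(\<Inter>j\<in>J. (\<lambda>f. f j) -` a j \<inter> space (PiM I A)) \<in> sets (PiM I A)"
    by (rule cylinder_sets[OF J a])
  moreover have "(\<Inter>j\<in>J. (\<lambda>f. f j) -` b j \<inter> space (PiM I B)) \<in> sets (PiM I B)"
    by (rule cylinder_sets[OF J b])
  ultimately show ?thesis
    by (simp only: indep_rv_prob[OF indep])
qed

lemma indep_rv_pair_prob:
  assumes indep: "indep_rv M (PiM I A) (\<lambda>\<omega>. \<lambda>i\<in>I. U i \<omega>) (PiM I B) (\<lambda>\<omega>. \<lambda>i\<in>I. V i \<omega>)"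
    and U: "\<And>i. i \<in> I \<Longrightarrow> U i \<in> measurable M (A i)"
    and V: "\<And>i. i \<in> I \<Longrightarrow> V i \<in> measurable M (B i)"
    and "i \<in> I" "a \<in> sets (A i)" "b \<in> sets (B i)"
  shows "prob ((\<lambda>\<omega>. (U i \<omega>, V i \<omega>)) -` (a \<times> b) \<inter> space M) =
    prob (U i -` a \<inter> space M) * prob (V i -` b \<inter> space M)"
proof -
  have "(\<lambda>\<omega>. (U i \<omega>, V i \<omega>)) -` (a \<times> b) \<inter> space M = (U i -` a \<inter> space M) \<inter> (V i -` b \<inter> space M)"
    by auto
  then show ?thesis
    using indep_rv_family_prob[OF indep _ _ _ U V, of "{i}" "\<lambda>_. a" "\<lambda>_. b"] assms(4-6) by simp
qed

lemma distr_pair_indep_rv: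
  assumes indep: "indep_rv M (PiM I A) (\<lambda>\<omega>. \<lambda>i\<in>I. U i \<omega>) (PiM I B) (\<lambda>\<omega>. \<lambda>i\<in>I. V i \<omega>)"
    and U: "\<And>i. i \<in> I \<Longrightarrow> U i \<in> measurable M (A i)"
    and V: "\<And>i. i \<in> I \<Longrightarrow> V i \<in> measurable M (B i)"
    and i: "i \<in> I"
  shows "distr M (A i \<Otimes>\<^sub>M B i) (\<lambda>\<omega>. (U i \<omega>, V i \<omega>)) = distr M (A i) (U i) \<Otimes>\<^sub>M distr M (B i) (V i)"
proof (rule pair_measure_eqI[symmetric])
  note [measurable] = U[OF i] V[OF i]
  show "sigma_finite_measure (distr M (A i) (U i))" "sigma_finite_measure (distr M (B i) (V i))"
    by (intro finite_measure.axioms(1) prob_space.axioms(1) prob_space_distr U V i)+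
  show "sets (distr M (A i) (U i) \<Otimes>\<^sub>M distr M (B i) (V i)) = sets (distr M (A i \<Otimes>\<^sub>M B i) (\<lambda>\<omega>. (U i \<omega>, V i \<omega>)))"
    by (simp cong: sets_pair_measure_cong)
  fix a b assume "a \<in> sets (distr M (A i) (U i))" "b \<in> sets (distr M (B i) (V i))"
  then show "emeasure (distr M (A i) (U i)) a * emeasure (distr M (B i) (V i)) b =
      emeasure (distr M (A i \<Otimes>\<^sub>M B i) (\<lambda>\<omega>. (U i \<omega>, V i \<omega>))) (a \<times> b)"
    using indep_rv_pair_prob[OF indep U V i, of a b]
    by (simp add: emeasure_distr emeasure_eq_measure ennreal_mult'')
qed

text \<open>
  Rectangles form an intersection-stable generator of the product \<open>\<sigma>\<close>-algebra. For rectangles the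
  joint probability splits first between the two families and then over the indices, and the
  factors recombine index by index.
\<close>
lemma indep_vars_Pair:
  assumes indep: "indep_rv M (PiM I A) (\<lambda>\<omega>. \<lambda>i\<in>I. U i \<omega>) (PiM I B) (\<lambda>\<omega>. \<lambda>i\<in>I. V i \<omega>)"
    and U: "indep_vars A U I" and V: "indep_vars B V I"
    and I: "finite I" "I \<noteq> {}"
  shows "indep_vars (\<lambda>i. A i \<Otimes>\<^sub>M B i) (\<lambda>i \<omega>. (U i \<omega>, V i \<omega>)) I"
proof -
  let ?Z = "\<lambda>i \<omega>. (U i \<omega>, V i \<omega>)"
  define G where "G i = {?Z i -` C \<inter> space M | C. C \<in> {a \<times> b | a b. a \<in> sets (A i) \<and> b \<in> sets (B i)}}" for i
  have Um: "U i \<in> measurable M (A i)" and Vm: "V i \<in> measurable M (B i)" if "i \<in> I" for i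
    using U V that by (auto simp: indep_vars_def)
  have Zm: "?Z i \<in> measurable M (A i \<Otimes>\<^sub>M B i)" if "i \<in> I" for i
    by (intro measurable_Pair Um Vm that)
  have "indep_sets G I"
  proof (rule iffD2[OF indep_sets_finite[OF I(2,1)]])
    fix i assume i: "i \<in> I"
    show "G i \<subseteq> events"
    proof
      fix E assume "E \<in> G i"
      then obtain a b where E: "E = ?Z i -` (a \<times> b) \<inter> space M" "a \<in> sets (A i)" "b \<in> sets (B i)"
        unfolding G_def by blast
      then have "a \<times> b \<in> sets (A i \<Otimes>\<^sub>M B i)"
        by (intro pair_measureI)
      then show "E \<in> events"
        unfolding E(1) by (rule measurable_sets[OF Zm[OF i]])
    qed
    have "?Z i -` (space (A i) \<times> space (B i)) \<inter> space M \<in> G i"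
      unfolding G_def by blast
    moreover have "?Z i -` (space (A i) \<times> space (B i)) \<inter> space M = space M"
    proof (intro Int_absorb1 subsetI vimageI2)
      fix x assume "x \<in> space M"
      then show "?Z i x \<in> space (A i) \<times> space (B i)"
        by (intro SigmaI measurable_space[OF Um[OF i]] measurable_space[OF Vm[OF i]])
    qed
    ultimately show "space M \<in> G i"
      by (rule back_subst)
  next
    show "\<forall>E\<in>Pi I G. prob (\<Inter>j\<in>I. E j) = (\<Prod>j\<in>I. prob (E j))"
    proof
      fix E assume E: "E \<in> Pi I G"
      have "\<forall>j\<in>I. \<exists>a b. E j = ?Z j -` (a \<times> b) \<inter> space M \<and> a \<in> sets (A j) \<and> b \<in> sets (B j)"
      proof
        fix j assume "j \<in> I"
        with E have "E j \<in> G j" by (rule Pi_mem)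
        then show "\<exists>a b. E j = ?Z j -` (a \<times> b) \<inter> space M \<and> a \<in> sets (A j) \<and> b \<in> sets (B j)"
          unfolding G_def by blast
      qed
      then obtain a b where ab: "\<forall>j\<in>I. E j = ?Z j -` (a j \<times> b j) \<inter> space M \<and> a j \<in> sets (A j) \<and> b j \<in> sets (B j)"
        unfolding bchoice_iff by blast
      have E: "E j = ?Z j -` (a j \<times> b j) \<inter> space M"
        and a: "a j \<in> sets (A j)" and b: "b j \<in> sets (B j)" if "j \<in> I" for j
        using ab that by blast+
      have "(\<Inter>j\<in>I. E j) = (\<Inter>j\<in>I. U j -` a j \<inter> space M) \<inter> (\<Inter>j\<in>I. V j -` b j \<inter> space M)"
        using E I(2) by (intro set_eqI) (simp, blast)
      then have "prob (\<Inter>j\<in>I. E j) = prob (\<Inter>j\<in>I. U j -` a j \<inter> space M) * prob (\<Inter>j\<in>I. V j -` b j \<inter> space M)"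
        by (simp only: indep_rv_family_prob[OF indep I(1,2) subset_refl Um Vm a b])
      also have "\<dots> = (\<Prod>j\<in>I. prob (U j -` a j \<inter> space M)) * (\<Prod>j\<in>I. prob (V j -` b j \<inter> space M))"
        by (simp only: indep_varsD_finite[OF U I(2,1) a] indep_varsD_finite[OF V I(2,1) b])
      also have "\<dots> = (\<Prod>j\<in>I. prob (E j))"
        unfolding prod.distrib[symmetric]
        by (intro prod.cong refl) (simp only: E indep_rv_pair_prob[OF indep Um Vm _ a b])
      finally show "prob (\<Inter>j\<in>I. E j) = (\<Prod>j\<in>I. prob (E j))" .
    qed
  qed
  moreover have "Int_stable (G i)" for i
  proof (rule Int_stableI)
    fix P Q assume "P \<in> G i" "Q \<in> G i"
    then obtain a b a' b' where *: "P = ?Z i -` (a \<times> b) \<inter> space M" "Q = ?Z i -` (a' \<times> b') \<inter> space M"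
      "a \<in> sets (A i)" "b \<in> sets (B i)" "a' \<in> sets (A i)" "b' \<in> sets (B i)"
      unfolding G_def by blast
    have "P \<inter> Q = ?Z i -` ((a \<inter> a') \<times> (b \<inter> b')) \<inter> space M"
      by (auto simp: *)
    moreover have "a \<inter> a' \<in> sets (A i)" "b \<inter> b' \<in> sets (B i)"
      using * by auto
    ultimately show "P \<inter> Q \<in> G i"
      unfolding G_def by blast
  qed
  ultimately have "indep_sets (\<lambda>i. sigma_sets (space M) (G i)) I"
    by (rule indep_sets_sigma)
  then have "indep_sets (\<lambda>i. {?Z i -` C \<inter> space M | C. C \<in> sets (A i \<Otimes>\<^sub>M B i)}) I"
  proof (rule indep_sets_mono_sets)
    fix i assume i: "i \<in> I"
    have "?Z i \<in> space M \<rightarrow> space (A i) \<times> space (B i)"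
      using measurable_space[OF Um[OF i]] measurable_space[OF Vm[OF i]] by auto
    from sigma_sets_vimage_commute[OF this]
    show "{?Z i -` C \<inter> space M | C. C \<in> sets (A i \<Otimes>\<^sub>M B i)} \<subseteq> sigma_sets (space M) (G i)"
      by (simp add: G_def sets_pair_measure)
  qed
  then show ?thesis
    using Zm by (simp add: indep_vars_def2)
qed

text \<open>
  This product form of the joint law takes the place of conditioning on the past: Fubini's theorem
  integrates out the fresh sample while a state computed from the past stays fixed.
\<close>
lemma distr_past_fresh:
  assumes Z: "indep_vars (\<lambda>_. K) Z {..T}" and t: "t \<le> (T :: nat)"
    and G: "G \<in> measurable (PiM {..<t} (\<lambda>_. K)) L"
  shows "distr M (L \<Otimes>\<^sub>M K) (\<lambda>\<omega>. (G (\<lambda>i\<in>{..<t}. Z i \<omega>), Z t \<omega>)) =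
    distr M L (\<lambda>\<omega>. G (\<lambda>i\<in>{..<t}. Z i \<omega>)) \<Otimes>\<^sub>M distr M K (Z t)"
proof -
  let ?P = "\<lambda>\<omega>. \<lambda>i\<in>{..<t}. Z i \<omega>" and ?Q = "\<lambda>\<omega>. \<lambda>i\<in>{t}. Z i \<omega>"
  let ?A = "PiM {..<t} (\<lambda>_. K)" and ?B = "PiM {t} (\<lambda>_. K)"
  have Zm: "Z i \<in> measurable M K" if "i \<le> T" for i
    using Z that by (auto simp: indep_vars_def)
  have P: "?P \<in> measurable M ?A" and Q: "?Q \<in> measurable M ?B"
    using t by (auto intro!: measurable_restrict Zm)
  have Qt: "(\<lambda>f. f t) \<in> measurable ?B K"
    by (rule measurable_component_singleton) simp
  have GP: "(\<lambda>\<omega>. G (?P \<omega>)) \<in> measurable M L"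
    by (rule measurable_compose[OF P G])
  have eqs: "distr (distr M ?A ?P) L G = distr M L (\<lambda>\<omega>. G (?P \<omega>))"
    "distr (distr M ?B ?Q) K (\<lambda>f. f t) = distr M K (Z t)"
    by (simp_all add: distr_distr[OF G P] distr_distr[OF Qt Q] comp_def)
  have "indep_var ?A ?P ?B ?Q"
    using t by (intro indep_var_restrict[OF Z]) auto
  then have "distr M ?A ?P \<Otimes>\<^sub>M distr M ?B ?Q = distr M (?A \<Otimes>\<^sub>M ?B) (\<lambda>\<omega>. (?P \<omega>, ?Q \<omega>))"
    by (simp add: indep_var_distribution_eq)
  moreover have "distr (distr M ?A ?P) L G \<Otimes>\<^sub>M distr (distr M ?B ?Q) K (\<lambda>f. f t) =
      distr (distr M ?A ?P \<Otimes>\<^sub>M distr M ?B ?Q) (L \<Otimes>\<^sub>M K) (\<lambda>(p, q). (G p, q t))"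
  proof (rule pair_measure_distr)
    show "sigma_finite_measure (distr (distr M ?B ?Q) K (\<lambda>f. f t))"
      unfolding eqs by (intro finite_measure.axioms(1) prob_space.axioms(1) prob_space_distr Zm t)
  qed (use G Qt in simp_all)
  ultimately have "distr M L (\<lambda>\<omega>. G (?P \<omega>)) \<Otimes>\<^sub>M distr M K (Z t) =
      distr (distr M (?A \<Otimes>\<^sub>M ?B) (\<lambda>\<omega>. (?P \<omega>, ?Q \<omega>))) (L \<Otimes>\<^sub>M K) (\<lambda>(p, q). (G p, q t))"
    by (simp only: eqs)
  also have "\<dots> = distr M (L \<Otimes>\<^sub>M K) (\<lambda>\<omega>. (G (?P \<omega>), Z t \<omega>))"
  proof (subst distr_distr)
    show "(\<lambda>(p, q). (G p, q t)) \<in> measurable (?A \<Otimes>\<^sub>M ?B) (L \<Otimes>\<^sub>M K)"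
      unfolding split_beta'
      by (intro measurable_Pair measurable_compose[OF measurable_fst G] measurable_compose[OF measurable_snd Qt])
    show "(\<lambda>\<omega>. (?P \<omega>, ?Q \<omega>)) \<in> measurable M (?A \<Otimes>\<^sub>M ?B)"
      by (intro measurable_Pair P Q)
  qed (simp add: comp_def)
  finally show ?thesis by simp
qed

end

section \<open>Second moments of the residuals\<close>

text \<open>
  The squared deviation \<open>q\<close> has nonnegative variance, so its mean is at most the root of the mean of
  \<open>q\<^sup>2\<close>, which is the fourth moment.
\<close>
lemma sphere_variance_bound:
  fixes h :: "'a::euclidean_space \<Rightarrow> real"
  assumes c: "sphere_moment_constant c" and M: "M > 0" and h: "M-lipschitz_on UNIV h"
  shows "(\<integral>u. (h u - (\<integral>v. h v \<partial>uniform_sphere))\<^sup>2 \<partial>uniform_sphere) \<le> c * M\<^sup>2 / DIM('a)"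
proof -
  define q where "q u = (h u - (\<integral>v. h v \<partial>uniform_sphere))\<^sup>2" for u
  have ch: "continuous_on UNIV h"
    by (rule lipschitz_on_continuous_on[OF h])
  have q: "continuous_on UNIV q"
    unfolding q_def by (intro continuous_intros ch)
  have "(\<integral>u. q u \<partial>uniform_sphere)\<^sup>2 \<le> (\<integral>u. (q u)\<^sup>2 \<partial>uniform_sphere)"
    using uniform_sphere.variance_eq[of q] uniform_sphere.variance_positive[of q]
    by (simp add: integrable_uniform_sphere q continuous_intros)
  then have "(\<integral>u. q u \<partial>uniform_sphere) \<le> sqrt (\<integral>u. (q u)\<^sup>2 \<partial>uniform_sphere)"
    by (rule real_le_rsqrt)
  also have "\<dots> \<le> c * M\<^sup>2 / DIM('a)"
    using sphere_moment_constantD[OF c M h] by (simp add: q_def flip: power_mult)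
  finally show ?thesis
    by (simp add: q_def)
qed

lemma lipschitz_on_sphere_average:
  fixes F :: "'a::euclidean_space \<Rightarrow> real"
  assumes lip: "L-lipschitz_on UNIV F"
  shows "L-lipschitz_on UNIV (\<lambda>z. \<integral>v. F (z + \<alpha> *\<^sub>R v) \<partial>uniform_sphere)"
proof (rule lipschitz_onI)
  show "0 \<le> L" by (rule lipschitz_on_nonneg[OF lip])
  fix y z :: 'a
  have int: "integrable uniform_sphere (\<lambda>v. F (z + \<alpha> *\<^sub>R v))" for z
    by (intro integrable_uniform_sphere continuous_on_compose2[OF lipschitz_on_continuous_on[OF lip]] continuous_intros) auto
  have "\<bar>(\<integral>v. F (y + \<alpha> *\<^sub>R v) \<partial>uniform_sphere) - (\<integral>v. F (z + \<alpha> *\<^sub>R v) \<partial>uniform_sphere)\<bar>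
      = \<bar>\<integral>v. F (y + \<alpha> *\<^sub>R v) - F (z + \<alpha> *\<^sub>R v) \<partial>uniform_sphere\<bar>"
    by (simp add: int)
  also have "\<dots> \<le> (\<integral>v. \<bar>F (y + \<alpha> *\<^sub>R v) - F (z + \<alpha> *\<^sub>R v)\<bar> \<partial>uniform_sphere)"
    by (rule integral_abs_bound)
  also have "\<dots> \<le> (\<integral>v. L * dist y z \<partial>(uniform_sphere :: 'a measure))"
  proof (rule integral_mono)
    show "\<bar>F (y + \<alpha> *\<^sub>R v) - F (z + \<alpha> *\<^sub>R v)\<bar> \<le> L * dist y z" for v
      using lipschitz_onD[OF lip, of "y + \<alpha> *\<^sub>R v" "z + \<alpha> *\<^sub>R v"] by (simp add: dist_real_def dist_norm)
  qed (simp_all add: int)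
  also have "\<dots> = L * dist y z"
    using uniform_sphere.prob_space[where 'a='a] by simp
  finally show "dist (\<integral>v. F (y + \<alpha> *\<^sub>R v) \<partial>uniform_sphere) (\<integral>v. F (z + \<alpha> *\<^sub>R v) \<partial>uniform_sphere) \<le> L * dist y z"
    by (simp add: dist_real_def)
qed

lemma residual_iterate_cong:
  assumes "\<And>i. i < t \<Longrightarrow> u i = u' i" "\<And>i. i < t \<Longrightarrow> s i = s' i"
  shows "residual_iterate f \<eta> \<alpha> x1 u s t = residual_iterate f \<eta> \<alpha> x1 u' s' t"
  using assms by (induction f \<eta> \<alpha> x1 u s t rule: residual_iterate.induct) auto

lemma measurable_residual_iterate:
  fixes f :: "'a::euclidean_space \<Rightarrow> 's \<Rightarrow> real"
  assumes f: "(\<lambda>(z, s). f z s) \<in> borel_measurable (borel \<Otimes>\<^sub>M S)"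
    and U: "\<And>i. i < t \<Longrightarrow> U i \<in> borel_measurable K"
    and V: "\<And>i. i < t \<Longrightarrow> V i \<in> measurable K S"
  shows "(\<lambda>k. residual_iterate f \<eta> \<alpha> x1 (\<lambda>i. U i k) (\<lambda>i. V i k) t) \<in> borel_measurable K"
  using U V
proof (induction t rule: less_induct)
  case (less t)
  let ?x = "\<lambda>t k. residual_iterate f \<eta> \<alpha> x1 (\<lambda>i. U i k) (\<lambda>i. V i k) t"
  show ?case
  proof (cases "t \<le> 1")
    case True
    then show ?thesis by (cases t) simp_all
  next
    case False
    then obtain r where t: "t = Suc (Suc r)"
      by (metis One_nat_def Suc_le_mono bot_nat_0.extremum not0_implies_Suc)
    have x[measurable]: "?x i \<in> borel_measurable K" if "i = r \<or> i = Suc r" for i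
      using that less t by auto
    have [measurable]: "U i \<in> borel_measurable K" "V i \<in> measurable K S" if "i = r \<or> i = Suc r" for i
      using that less.prems t by auto
    have "(\<lambda>k. f (?x i k + \<alpha> *\<^sub>R U i k) (V i k)) \<in> borel_measurable K" if i: "i = r \<or> i = Suc r" for i
      using i by (intro measurable_Pair_compose_split[OF f]) measurable
    note [measurable] = this
    show ?thesis
      unfolding t residual_iterate.simps residual_grad_def by measurable
  qed
qed

lemma (in prob_space) integrable_nonneg_bounded:
  assumes h: "h \<in> borel_measurable M" "\<And>\<omega>. 0 \<le> h \<omega>" and B: "0 \<le> B"
    and le: "(\<integral>\<^sup>+\<omega>. ennreal (h \<omega>) \<partial>M) \<le> ennreal B"
  shows "integrable M h" "expectation h \<le> B"
proof -
  show *: "integrable M h"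
    by (rule integrableI_nonneg) (use h le in \<open>auto simp: le_less_trans\<close>)
  then show "expectation h \<le> B"
    using le h(2) B by (simp add: nn_integral_eq_integral)
qed

locale residual_feedback = prob_space M + N: prob_space N
  for M :: "'w measure" and N :: "'v measure" +
  fixes S :: "'s measure" and \<xi> :: "'v \<Rightarrow> 's"
    and f :: "'a::euclidean_space \<Rightarrow> 's \<Rightarrow> real" and F :: "'a \<Rightarrow> real"
    and u :: "nat \<Rightarrow> 'w \<Rightarrow> 'a" and \<xi>s :: "nat \<Rightarrow> 'w \<Rightarrow> 's"
    and x1 :: 'a and c0 L0 \<sigma>0 \<alpha> \<eta> :: real and T :: nat
  assumes c0: "c0 > 0" "sphere_moment_constant c0"
    and \<xi>: "\<xi> \<in> measurable N S"
    and f_meas: "(\<lambda>(z, s). f z s) \<in> borel_measurable (borel \<Otimes>\<^sub>M S)"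
    and f_int: "\<And>z. integrable N (\<lambda>\<omega>. f z (\<xi> \<omega>))"
    and F: "\<And>z. F z = N.expectation (\<lambda>\<omega>. f z (\<xi> \<omega>))"
    and convex: "convex_on UNIV F"
    and L0: "L0 > 0" and lipschitz: "L0-lipschitz_on UNIV F"
    and var_int: "\<And>z. integrable N (\<lambda>\<omega>. (f z (\<xi> \<omega>) - F z)\<^sup>2)"
    and var: "\<And>z. N.expectation (\<lambda>\<omega>. (f z (\<xi> \<omega>) - F z)\<^sup>2) \<le> \<sigma>0\<^sup>2"
    and u_indep: "indep_vars (\<lambda>_. borel) u {..T}"
    and u_distr: "\<And>t. t \<le> T \<Longrightarrow> distr M borel (u t) = uniform_sphere"
    and \<xi>s_indep: "indep_vars (\<lambda>_. S) \<xi>s {..T}"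
    and \<xi>s_distr: "\<And>t. t \<le> T \<Longrightarrow> distr M S (\<xi>s t) = distr N S \<xi>"
    and u_\<xi>s_indep: "indep_rv M
          (\<Pi>\<^sub>M t\<in>{..T}. borel) (\<lambda>\<omega>. \<lambda>t\<in>{..T}. u t \<omega>)
          (\<Pi>\<^sub>M t\<in>{..T}. S) (\<lambda>\<omega>. \<lambda>t\<in>{..T}. \<xi>s t \<omega>)"
    and \<alpha>: "\<alpha> > 0"
    and \<eta>: "0 < \<eta>" "\<eta> \<le> \<alpha> / (3 * real DIM('a) * L0)"
begin

definition "iter t \<omega> = residual_iterate f \<eta> \<alpha> x1 (\<lambda>i. u i \<omega>) (\<lambda>i. \<xi>s i \<omega>) t"

definition "obs t \<omega> = f (iter t \<omega> + \<alpha> *\<^sub>R u t \<omega>) (\<xi>s t \<omega>)"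

text \<open>
  The value at \<open>0\<close> is arbitrary, since the algorithm forms its first residual at \<open>t = 1\<close>.
\<close>
definition "prev_obs t \<omega> = (case t of 0 \<Rightarrow> 0 | Suc k \<Rightarrow> obs k \<omega>)"

definition "residual t \<omega> = obs t \<omega> - prev_obs t \<omega>"

definition "d = real DIM('a)"

definition "sample_law = (uniform_sphere :: 'a measure) \<Otimes>\<^sub>M distr N S \<xi>"

definition "smoothed z = (\<integral>v. F (z + \<alpha> *\<^sub>R v) \<partial>uniform_sphere)"

text \<open>
  What a single observation contributes to the second moment of a residual: the variance of the
  noise, and the variance of \<open>F\<close> on the sphere of radius \<open>\<alpha>\<close> around the iterate.
\<close>
definition "\<kappa> = \<sigma>0\<^sup>2 + c0 * (L0 * \<alpha>)\<^sup>2 / d"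

lemma d_pos: "d > 0"
  by (simp add: d_def)

lemma \<kappa>_nonneg: "0 \<le> \<kappa>"
  using c0 d_pos by (simp add: \<kappa>_def)

lemma u_meas: "t \<le> T \<Longrightarrow> u t \<in> borel_measurable M"
  using u_indep by (simp add: indep_vars_def)

lemma \<xi>s_meas: "t \<le> T \<Longrightarrow> \<xi>s t \<in> measurable M S"
  using \<xi>s_indep by (simp add: indep_vars_def)

lemma f_meas_compose [measurable (raw)]:
  "g \<in> borel_measurable K \<Longrightarrow> h \<in> measurable K S \<Longrightarrow> (\<lambda>k. f (g k) (h k)) \<in> borel_measurable K"
  by (rule measurable_Pair_compose_split[OF f_meas])

lemma F_cont: "continuous_on A F"
  using lipschitz_on_continuous_on[OF lipschitz] continuous_on_subset by blast

lemma F_meas [measurable]: "F \<in> borel_measurable borel"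
  by (rule borel_measurable_continuous_onI[OF F_cont])

lemma smoothed_lipschitz: "L0-lipschitz_on UNIV smoothed"
  using lipschitz_on_sphere_average[OF lipschitz] by (simp add: smoothed_def[abs_def])

lemma smoothed_meas [measurable]: "smoothed \<in> borel_measurable borel"
  by (rule borel_measurable_continuous_onI[OF lipschitz_on_continuous_on[OF smoothed_lipschitz]])

lemma iter_meas [measurable]: "t \<le> Suc T \<Longrightarrow> iter t \<in> borel_measurable M"
  unfolding iter_def[abs_def]
  by (rule measurable_residual_iterate[OF f_meas]) (simp_all add: u_meas \<xi>s_meas)

lemma obs_meas: "t \<le> T \<Longrightarrow> obs t \<in> borel_measurable M"
  unfolding obs_def[abs_def] using u_meas[of t] \<xi>s_meas[of t] iter_meas[of t] by measurable

lemma prev_obs_meas: "t \<le> T \<Longrightarrow> prev_obs t \<in> borel_measurable M"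
  using obs_meas[of "t - 1"] by (cases t) (simp_all add: prev_obs_def[abs_def])

lemma residual_meas: "t \<le> T \<Longrightarrow> residual t \<in> borel_measurable M"
  unfolding residual_def[abs_def] by (intro borel_measurable_diff obs_meas prev_obs_meas)

lemma iter_1: "iter (Suc 0) \<omega> = x1"
  by (simp add: iter_def)

lemma iter_Suc:
  assumes "t \<ge> 1"
  shows "iter (Suc t) \<omega> = iter t \<omega> - (\<eta> * d / \<alpha> * residual t \<omega>) *\<^sub>R u t \<omega>"
  using assms
  by (cases t) (simp_all add: iter_def residual_grad_def residual_def obs_def prev_obs_def d_def)

lemma prob_space_noise: "prob_space (distr N S \<xi>)"
  by (rule N.prob_space_distr[OF \<xi>])

lemma prob_space_sample_law: "prob_space sample_law"
  unfolding sample_law_def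
  by (intro prob_space_pair) (rule uniform_sphere.prob_space_axioms prob_space_noise)+

lemma sets_sample_law [measurable_cong]: "sets sample_law = sets (borel \<Otimes>\<^sub>M S)"
  unfolding sample_law_def by (intro sets_pair_measure_cong) simp_all

text \<open>
  The previous observation belongs to the state because the residual subtracts it.
\<close>
lemma distr_state_sample:
  assumes t: "t \<le> T"
  shows "distr M ((borel \<Otimes>\<^sub>M borel) \<Otimes>\<^sub>M (borel \<Otimes>\<^sub>M S))
      (\<lambda>\<omega>. ((iter t \<omega>, prev_obs t \<omega>), (u t \<omega>, \<xi>s t \<omega>))) =
    distr M (borel \<Otimes>\<^sub>M borel) (\<lambda>\<omega>. (iter t \<omega>, prev_obs t \<omega>)) \<Otimes>\<^sub>M sample_law"
proof -
  let ?K = "borel \<Otimes>\<^sub>M S :: ('a \<times> 's) measure" and ?L = "borel \<Otimes>\<^sub>M borel :: ('a \<times> real) measure"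
  let ?P = "PiM {..<t} (\<lambda>_. ?K)"
  let ?Z = "\<lambda>i \<omega>. (u i \<omega>, \<xi>s i \<omega>)"
  let ?x = "\<lambda>i p. residual_iterate f \<eta> \<alpha> x1 (\<lambda>i. fst (p i)) (\<lambda>i. snd (p i)) i"
  \<comment> \<open>\<open>G\<close> computes the state from the samples before time \<open>t\<close>.\<close>
  define G where "G p = (?x t p, case t of 0 \<Rightarrow> 0 | Suc k \<Rightarrow> f (?x k p + \<alpha> *\<^sub>R fst (p k)) (snd (p k)))"
    for p :: "nat \<Rightarrow> 'a \<times> 's"
  have comp: "(\<lambda>p. fst (p i)) \<in> borel_measurable ?P" "(\<lambda>p. snd (p i)) \<in> measurable ?P S" if "i < t" for i
    using that by (auto intro!: measurable_compose[OF measurable_component_singleton])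
  have x: "?x i \<in> borel_measurable ?P" if "i \<le> t" for i
    using that comp by (intro measurable_residual_iterate[OF f_meas]) auto
  have "(\<lambda>p. case t of 0 \<Rightarrow> 0 | Suc k \<Rightarrow> f (?x k p + \<alpha> *\<^sub>R fst (p k)) (snd (p k))) \<in> borel_measurable ?P"
  proof (cases t)
    case (Suc k)
    then have "?x k \<in> borel_measurable ?P" "(\<lambda>p. fst (p k)) \<in> borel_measurable ?P"
        "(\<lambda>p. snd (p k)) \<in> measurable ?P S"
      using x comp by auto
    then show ?thesis
      unfolding Suc nat.case by measurable
  qed simp
  then have G: "G \<in> measurable ?P ?L"
    unfolding G_def[abs_def] by (intro measurable_Pair x) auto
  have past: "G (\<lambda>i\<in>{..<t}. ?Z i \<omega>) = (iter t \<omega>, prev_obs t \<omega>)" for \<omega>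
  proof -
    have "?x i (\<lambda>i\<in>{..<t}. ?Z i \<omega>) = iter i \<omega>" if "i \<le> t" for i
      unfolding iter_def using that by (intro residual_iterate_cong) auto
    then show ?thesis
      by (cases t) (simp_all add: G_def prev_obs_def obs_def)
  qed
  have Z: "indep_vars (\<lambda>_. ?K) ?Z {..T}"
    by (rule indep_vars_Pair[OF u_\<xi>s_indep u_indep \<xi>s_indep]) auto
  have "distr M ?K (?Z t) = distr M borel (u t) \<Otimes>\<^sub>M distr M S (\<xi>s t)"
    using t by (intro distr_pair_indep_rv[OF u_\<xi>s_indep]) (auto intro: u_meas \<xi>s_meas)
  also have "\<dots> = sample_law"
    by (simp only: sample_law_def u_distr[OF t] \<xi>s_distr[OF t])
  finally show ?thesis
    using distr_past_fresh[OF Z t G] by (simp only: past)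
qed

text \<open>
  Stated for nonnegative integrals so that it yields moments of the random quantities before
  anything is known about their integrability.
\<close>
lemma nn_integral_sample_bound:
  assumes t: "t \<le> T" and h: "h \<in> borel_measurable (borel \<Otimes>\<^sub>M (borel \<Otimes>\<^sub>M S))"
    and B: "\<And>z. (\<integral>\<^sup>+q. h (z, q) \<partial>sample_law) \<le> B"
  shows "(\<integral>\<^sup>+\<omega>. h (iter t \<omega>, (u t \<omega>, \<xi>s t \<omega>)) \<partial>M) \<le> B"
proof -
  interpret Q: prob_space sample_law by (rule prob_space_sample_law)
  note [measurable] = u_meas[OF t] \<xi>s_meas[OF t] iter_meas[OF le_SucI[OF t]] prev_obs_meas[OF t] h
  let ?X = "\<lambda>\<omega>. (iter t \<omega>, prev_obs t \<omega>)" and ?Z = "\<lambda>\<omega>. (u t \<omega>, \<xi>s t \<omega>)"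
  let ?PX = "distr M (borel \<Otimes>\<^sub>M borel) ?X"
  have [measurable]: "(\<lambda>p. h (fst (fst p), snd p)) \<in> borel_measurable ((borel \<Otimes>\<^sub>M borel) \<Otimes>\<^sub>M (borel \<Otimes>\<^sub>M S))"
    by (rule measurable_compose[OF _ h]) measurable
  have sets: "sets (?PX \<Otimes>\<^sub>M sample_law) = sets ((borel \<Otimes>\<^sub>M borel) \<Otimes>\<^sub>M (borel \<Otimes>\<^sub>M S))"
    by (intro sets_pair_measure_cong) (simp_all add: sets_sample_law)
  have hm: "(\<lambda>p. h (fst (fst p), snd p)) \<in> borel_measurable (?PX \<Otimes>\<^sub>M sample_law)"
    by (subst measurable_cong_sets[OF sets refl]) measurable
  have "(\<integral>\<^sup>+\<omega>. h (iter t \<omega>, ?Z \<omega>) \<partial>M) =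
      (\<integral>\<^sup>+p. h (fst (fst p), snd p) \<partial>distr M ((borel \<Otimes>\<^sub>M borel) \<Otimes>\<^sub>M (borel \<Otimes>\<^sub>M S)) (\<lambda>\<omega>. (?X \<omega>, ?Z \<omega>)))"
    by (subst nn_integral_distr) simp_all
  also have "\<dots> = (\<integral>\<^sup>+p. h (fst (fst p), snd p) \<partial>(?PX \<Otimes>\<^sub>M sample_law))"
    by (simp only: distr_state_sample[OF t])
  also have "\<dots> = (\<integral>\<^sup>+p. \<integral>\<^sup>+q. h (fst p, q) \<partial>sample_law \<partial>?PX)"
    by (subst Q.nn_integral_fst[symmetric, OF hm]) simp
  also have "\<dots> \<le> (\<integral>\<^sup>+p. B \<partial>?PX)"
    by (intro nn_integral_mono B)
  also have "\<dots> = B"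
  proof -
    interpret PX: prob_space ?PX by (rule prob_space_distr) simp
    show ?thesis using PX.emeasure_space_1 by simp
  qed
  finally show ?thesis .
qed

text \<open>
  An observation is the smoothed objective at the iterate plus the next two errors.
\<close>
definition "noise t \<omega> = obs t \<omega> - F (iter t \<omega> + \<alpha> *\<^sub>R u t \<omega>)"

definition "spread t \<omega> = F (iter t \<omega> + \<alpha> *\<^sub>R u t \<omega>) - smoothed (iter t \<omega>)"

lemma noise_meas: "t \<le> T \<Longrightarrow> noise t \<in> borel_measurable M"
  unfolding noise_def[abs_def]
  using u_meas[of t] iter_meas[of t] obs_meas[of t] by measurable

lemma spread_meas: "t \<le> T \<Longrightarrow> spread t \<in> borel_measurable M"
  unfolding spread_def[abs_def]
  using u_meas[of t] iter_meas[of t] by measurable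

lemma noise_law:
  shows integrable_noise_law: "integrable (distr N S \<xi>) (f z)"
    and integral_noise_law: "(\<integral>s. f z s \<partial>distr N S \<xi>) = F z"
    and nn_integral_noise_law: "(\<integral>\<^sup>+s. ennreal ((f z s - F z)\<^sup>2) \<partial>distr N S \<xi>) \<le> ennreal (\<sigma>0\<^sup>2)"
proof -
  note [measurable] = \<xi>
  have fz[measurable]: "f z \<in> borel_measurable S"
    by measurable
  show "integrable (distr N S \<xi>) (f z)"
    by (subst integrable_distr_eq) (simp_all add: f_int)
  show "(\<integral>s. f z s \<partial>distr N S \<xi>) = F z"
    by (subst integral_distr) (simp_all add: F)
  have "(\<integral>\<^sup>+s. ennreal ((f z s - F z)\<^sup>2) \<partial>distr N S \<xi>) = (\<integral>\<^sup>+\<omega>. ennreal ((f z (\<xi> \<omega>) - F z)\<^sup>2) \<partial>N)"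
    by (subst nn_integral_distr) simp_all
  also have "\<dots> = ennreal (N.expectation (\<lambda>\<omega>. (f z (\<xi> \<omega>) - F z)\<^sup>2))"
    by (intro nn_integral_eq_integral var_int) simp
  also have "\<dots> \<le> ennreal (\<sigma>0\<^sup>2)"
    by (intro ennreal_leI var)
  finally show "(\<integral>\<^sup>+s. ennreal ((f z s - F z)\<^sup>2) \<partial>distr N S \<xi>) \<le> ennreal (\<sigma>0\<^sup>2)" .
qed

lemma noise_moment:
  assumes t: "t \<le> T"
  shows "(\<integral>\<^sup>+\<omega>. ennreal ((noise t \<omega>)\<^sup>2) \<partial>M) \<le> ennreal (\<sigma>0\<^sup>2)"
proof -
  interpret R: prob_space "distr N S \<xi>" by (rule prob_space_noise)
  let ?h = "\<lambda>(z, v, s). ennreal ((f (z + \<alpha> *\<^sub>R v) s - F (z + \<alpha> *\<^sub>R v))\<^sup>2)"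
  have h: "?h \<in> borel_measurable (borel \<Otimes>\<^sub>M (borel \<Otimes>\<^sub>M S))"
    by measurable
  have "(\<integral>\<^sup>+\<omega>. ?h (iter t \<omega>, u t \<omega>, \<xi>s t \<omega>) \<partial>M) \<le> ennreal (\<sigma>0\<^sup>2)"
  proof (rule nn_integral_sample_bound[OF t h])
    fix z :: 'a
    have hz: "(\<lambda>q. ?h (z, q)) \<in> borel_measurable (uniform_sphere \<Otimes>\<^sub>M distr N S \<xi>)"
      unfolding split_beta fst_conv snd_conv by measurable
    have "(\<integral>\<^sup>+q. ?h (z, q) \<partial>sample_law) = (\<integral>\<^sup>+v. \<integral>\<^sup>+s. ?h (z, v, s) \<partial>distr N S \<xi> \<partial>uniform_sphere)"
      unfolding sample_law_def by (rule R.nn_integral_fst[OF hz, symmetric])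
    also have "\<dots> \<le> (\<integral>\<^sup>+v. ennreal (\<sigma>0\<^sup>2) \<partial>(uniform_sphere :: 'a measure))"
      unfolding split by (intro nn_integral_mono nn_integral_noise_law)
    also have "\<dots> = ennreal (\<sigma>0\<^sup>2)"
      using uniform_sphere.emeasure_space_1[where 'a='a] by simp
    finally show "(\<integral>\<^sup>+q. ?h (z, q) \<partial>sample_law) \<le> ennreal (\<sigma>0\<^sup>2)" .
  qed
  then show ?thesis
    by (simp add: noise_def obs_def)
qed

text \<open>
  Seen as a function of the direction, \<open>F\<close> on the sphere of radius \<open>\<alpha>\<close> around \<open>z\<close> is
  \<open>L\<^sub>0 \<alpha>\<close>-Lipschitz, and \<open>smoothed z\<close> is its mean.
\<close>
lemma spread_moment:
  assumes t: "t \<le> T"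
  shows "(\<integral>\<^sup>+\<omega>. ennreal ((spread t \<omega>)\<^sup>2) \<partial>M) \<le> ennreal (c0 * (L0 * \<alpha>)\<^sup>2 / d)"
proof -
  interpret R: prob_space "distr N S \<xi>" by (rule prob_space_noise)
  let ?h = "\<lambda>(z, v, s :: 's). ennreal ((F (z + \<alpha> *\<^sub>R v) - smoothed z)\<^sup>2)"
  have h: "?h \<in> borel_measurable (borel \<Otimes>\<^sub>M (borel \<Otimes>\<^sub>M S))"
    by measurable
  have "(\<integral>\<^sup>+\<omega>. ?h (iter t \<omega>, u t \<omega>, \<xi>s t \<omega>) \<partial>M) \<le> ennreal (c0 * (L0 * \<alpha>)\<^sup>2 / d)"
  proof (rule nn_integral_sample_bound[OF t h])
    fix z :: 'a
    have hz: "(\<lambda>q. ?h (z, q)) \<in> borel_measurable (uniform_sphere \<Otimes>\<^sub>M distr N S \<xi>)"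
      unfolding split_beta fst_conv snd_conv by measurable
    have "(\<integral>\<^sup>+q. ?h (z, q) \<partial>sample_law) = (\<integral>\<^sup>+v. \<integral>\<^sup>+s. ?h (z, v, s) \<partial>distr N S \<xi> \<partial>uniform_sphere)"
      unfolding sample_law_def by (rule R.nn_integral_fst[OF hz, symmetric])
    also have "\<dots> = (\<integral>\<^sup>+v. ennreal ((F (z + \<alpha> *\<^sub>R v) - smoothed z)\<^sup>2) \<partial>uniform_sphere)"
      using R.emeasure_space_1 by simp
    also have "\<dots> = ennreal (\<integral>v. (F (z + \<alpha> *\<^sub>R v) - smoothed z)\<^sup>2 \<partial>uniform_sphere)"
      by (intro nn_integral_eq_integral integrable_uniform_sphere continuous_intros
          continuous_on_compose2[OF F_cont[of UNIV]]) auto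
    also have "\<dots> \<le> ennreal (c0 * (L0 * \<alpha>)\<^sup>2 / d)"
    proof (rule ennreal_leI)
      have "(L0 * \<alpha>)-lipschitz_on UNIV (\<lambda>v. F (z + \<alpha> *\<^sub>R v))"
      proof (rule lipschitz_onI)
        fix v w :: 'a
        show "dist (F (z + \<alpha> *\<^sub>R v)) (F (z + \<alpha> *\<^sub>R w)) \<le> L0 * \<alpha> * dist v w"
          using lipschitz_onD[OF lipschitz, of "z + \<alpha> *\<^sub>R v" "z + \<alpha> *\<^sub>R w"] \<alpha>
          by (simp add: dist_norm flip: scaleR_diff_right)
      qed (use L0 \<alpha> in simp)
      from sphere_variance_bound[OF c0(2) _ this]
      show "(\<integral>v. (F (z + \<alpha> *\<^sub>R v) - smoothed z)\<^sup>2 \<partial>uniform_sphere) \<le> c0 * (L0 * \<alpha>)\<^sup>2 / d"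
        using L0 \<alpha> by (simp add: smoothed_def d_def)
    qed
    finally show "(\<integral>\<^sup>+q. ?h (z, q) \<partial>sample_law) \<le> ennreal (c0 * (L0 * \<alpha>)\<^sup>2 / d)" .
  qed
  then show ?thesis
    by (simp add: spread_def)
qed

definition "fluctuation t \<omega> = (noise t \<omega>)\<^sup>2 + (spread t \<omega>)\<^sup>2"

lemma fluctuation_moment:
  assumes t: "t \<le> T"
  shows "integrable M (fluctuation t)" "expectation (fluctuation t) \<le> \<kappa>"
proof -
  have n: "integrable M (\<lambda>\<omega>. (noise t \<omega>)\<^sup>2)" "expectation (\<lambda>\<omega>. (noise t \<omega>)\<^sup>2) \<le> \<sigma>0\<^sup>2"
    using noise_moment[OF t] noise_meas[OF t] by (intro integrable_nonneg_bounded; simp)+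
  have s: "integrable M (\<lambda>\<omega>. (spread t \<omega>)\<^sup>2)" "expectation (\<lambda>\<omega>. (spread t \<omega>)\<^sup>2) \<le> c0 * (L0 * \<alpha>)\<^sup>2 / d"
    using spread_moment[OF t] spread_meas[OF t] c0 d_pos by (intro integrable_nonneg_bounded; simp)+
  show "integrable M (fluctuation t)" "expectation (fluctuation t) \<le> \<kappa>"
    using n s by (simp_all add: fluctuation_def[abs_def] \<kappa>_def)
qed

lemma AE_norm_u:
  assumes "t \<le> T"
  shows "AE \<omega> in M. norm (u t \<omega>) = 1"
proof (rule AE_distrD[OF u_meas[OF assms]])
  show "AE v in distr M borel (u t). norm v = 1"
    by (subst u_distr[OF assms]) (rule AE_uniform_sphere_norm)
qed

text \<open>
  The residual is a difference of noises, plus a difference of spreads, plus the change of the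
  smoothed objective, which the Lipschitz constant controls. The square of a sum of three terms
  costs the factor \<open>3\<close>, and each of the two differences another factor \<open>2\<close>.
\<close>
lemma residual_decomp:
  assumes "t \<ge> 1"
  shows "(residual t \<omega>)\<^sup>2 \<le> 6 * fluctuation t \<omega> + 6 * fluctuation (t - 1) \<omega> +
    3 * (L0 * norm (iter t \<omega> - iter (t - 1) \<omega>))\<^sup>2"
proof -
  define m where "m = smoothed (iter t \<omega>) - smoothed (iter (t - 1) \<omega>)"
  define a b a' b' where "a = noise t \<omega>" "b = spread t \<omega>" "a' = noise (t - 1) \<omega>" "b' = spread (t - 1) \<omega>"
  have "\<bar>m\<bar> \<le> L0 * norm (iter t \<omega> - iter (t - 1) \<omega>)"
    using lipschitz_onD[OF smoothed_lipschitz, of "iter t \<omega>" "iter (t - 1) \<omega>"]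
    by (simp add: m_def dist_norm)
  then have m: "m\<^sup>2 \<le> (L0 * norm (iter t \<omega> - iter (t - 1) \<omega>))\<^sup>2"
    by (metis abs_ge_zero power2_abs power_mono)
  have "residual t \<omega> = a + b - a' - b' + m"
    using assms by (cases t) (simp_all add: residual_def prev_obs_def a_b_a'_b'_def noise_def spread_def m_def)
  moreover have "(a + b - a' - b' + m)\<^sup>2 \<le> 6 * (a\<^sup>2 + b\<^sup>2) + 6 * (a'\<^sup>2 + b'\<^sup>2) + 3 * m\<^sup>2"
  proof -
    \<comment> \<open>With \<open>p = a - a'\<close> and \<open>q = b - b'\<close>: \<open>3 (p\<^sup>2 + q\<^sup>2 + m\<^sup>2) - (p + q + m)\<^sup>2\<close> is the sum of the
      squared pairwise differences.\<close>
    have "6 * (a\<^sup>2 + b\<^sup>2) + 6 * (a'\<^sup>2 + b'\<^sup>2) + 3 * m\<^sup>2 - (a + b - a' - b' + m)\<^sup>2 =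
       3 * (a + a')\<^sup>2 + 3 * (b + b')\<^sup>2 + ((a - a') - (b - b'))\<^sup>2 + ((a - a') - m)\<^sup>2 + ((b - b') - m)\<^sup>2"
      by (simp add: power2_eq_square algebra_simps)
    then show ?thesis
      by (smt (verit) zero_le_power2)
  qed
  ultimately show ?thesis
    using m by (simp add: fluctuation_def a_b_a'_b'_def)
qed

lemma step_size: "\<eta> * d / \<alpha> * L0 \<le> 1 / 3"
  using \<eta>(2) \<alpha> L0 d_pos unfolding d_def[symmetric] by (simp add: field_simps)

text \<open>
  The iterate moves by a multiple of the previous residual, and the step size is small enough that
  the drift term feeds back at most \<open>1 / 3\<close> of the previous second moment. The recursion
  \<open>m \<le> 12 \<kappa> + m' / 3\<close> has the fixed point \<open>18 \<kappa>\<close>; it starts below it because \<open>x\<^sub>0 = x\<^sub>1\<close> leaves no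
  drift at \<open>t = 1\<close>.
\<close>
lemma residual_moment:
  assumes "1 \<le> t" "t \<le> T"
  shows "integrable M (\<lambda>\<omega>. (residual t \<omega>)\<^sup>2) \<and> expectation (\<lambda>\<omega>. (residual t \<omega>)\<^sup>2) \<le> 18 * \<kappa>"
  using assms
proof (induction t rule: nat_induct_at_least)
  case base
  let ?B = "\<lambda>\<omega>. 6 * fluctuation 1 \<omega> + 6 * fluctuation 0 \<omega>"
  have B: "integrable M ?B" "expectation ?B \<le> 12 * \<kappa>"
    using fluctuation_moment[of 1] fluctuation_moment[of 0] base by simp_all
  have le: "(residual 1 \<omega>)\<^sup>2 \<le> ?B \<omega>" for \<omega>
    using residual_decomp[of 1 \<omega>] by (simp add: iter_def)
  have "integrable M (\<lambda>\<omega>. (residual 1 \<omega>)\<^sup>2)"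
    by (rule Bochner_Integration.integrable_bound[OF B(1)])
      (use le residual_meas[of 1] base in \<open>auto intro!: AE_I2 intro: order_trans[OF _ abs_ge_self]\<close>)
  moreover from this have "expectation (\<lambda>\<omega>. (residual 1 \<omega>)\<^sup>2) \<le> expectation ?B"
    by (intro integral_mono B le)
  ultimately show ?case
    using B(2) \<kappa>_nonneg by simp
next
  case (Suc t)
  let ?B = "\<lambda>\<omega>. 6 * fluctuation (Suc t) \<omega> + 6 * fluctuation t \<omega> + 1 / 3 * (residual t \<omega>)\<^sup>2"
  have IH: "integrable M (\<lambda>\<omega>. (residual t \<omega>)\<^sup>2)" "expectation (\<lambda>\<omega>. (residual t \<omega>)\<^sup>2) \<le> 18 * \<kappa>"
    using Suc by simp_all
  have B: "integrable M ?B" "expectation ?B \<le> 18 * \<kappa>"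
    using fluctuation_moment[of "Suc t"] fluctuation_moment[of t] Suc.prems IH by simp_all
  have "AE \<omega> in M. norm (u t \<omega>) = 1"
    using Suc.prems by (intro AE_norm_u) simp
  then have le: "AE \<omega> in M. (residual (Suc t) \<omega>)\<^sup>2 \<le> ?B \<omega>"
  proof eventually_elim
    case (elim \<omega>)
    let ?k = "\<eta> * d / \<alpha>"
    have k: "0 \<le> ?k" using \<eta> d_pos \<alpha> by simp
    have "iter (Suc t) \<omega> - iter t \<omega> = - ((?k * residual t \<omega>) *\<^sub>R u t \<omega>)"
      by (simp add: iter_Suc[OF Suc.hyps])
    then have "norm (iter (Suc t) \<omega> - iter t \<omega>) = ?k * \<bar>residual t \<omega>\<bar>"
      by (simp only: norm_minus_cancel norm_scaleR abs_mult abs_of_nonneg[OF k] elim mult_1_right)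
    then have "L0 * norm (iter (Suc t) \<omega> - iter t \<omega>) = (?k * L0) * \<bar>residual t \<omega>\<bar>"
      by simp
    also have "\<dots> \<le> 1 / 3 * \<bar>residual t \<omega>\<bar>"
      by (intro mult_right_mono step_size) simp
    finally have "(L0 * norm (iter (Suc t) \<omega> - iter t \<omega>))\<^sup>2 \<le> (1 / 3 * \<bar>residual t \<omega>\<bar>)\<^sup>2"
      using L0 by (intro power_mono) auto
    also have "\<dots> = 1 / 9 * (residual t \<omega>)\<^sup>2"
      by (simp add: power2_eq_square)
    finally have "(L0 * norm (iter (Suc t) \<omega> - iter t \<omega>))\<^sup>2 \<le> 1 / 9 * (residual t \<omega>)\<^sup>2" .
    then show ?case
      using residual_decomp[of "Suc t" \<omega>] by simp
  qed
  have "integrable M (\<lambda>\<omega>. (residual (Suc t) \<omega>)\<^sup>2)"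
  proof (rule Bochner_Integration.integrable_bound[OF B(1)])
    show "(\<lambda>\<omega>. (residual (Suc t) \<omega>)\<^sup>2) \<in> borel_measurable M"
      using residual_meas[of "Suc t"] Suc.prems by simp
    show "AE \<omega> in M. norm ((residual (Suc t) \<omega>)\<^sup>2) \<le> norm (?B \<omega>)"
      using le by eventually_elim simp
  qed
  moreover from this have "expectation (\<lambda>\<omega>. (residual (Suc t) \<omega>)\<^sup>2) \<le> expectation ?B"
    by (intro integral_mono_AE B le)
  ultimately show ?case
    using B(2) by simp
qed

section \<open>Descent and averaging\<close>
lemma integrable_progress:
  assumes "1 \<le> t" "t \<le> T" and sq: "integrable M (\<lambda>\<omega>. (norm (iter t \<omega> - y))\<^sup>2)"
  shows "integrable M (\<lambda>\<omega>. residual t \<omega> * (u t \<omega> \<bullet> (iter t \<omega> - y)))"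
proof (rule Bochner_Integration.integrable_bound)
  show "integrable M (\<lambda>\<omega>. (residual t \<omega>)\<^sup>2 + (norm (iter t \<omega> - y))\<^sup>2)"
    using residual_moment[OF assms(1,2)] sq by simp
  show "(\<lambda>\<omega>. residual t \<omega> * (u t \<omega> \<bullet> (iter t \<omega> - y))) \<in> borel_measurable M"
    using residual_meas[of t] u_meas[of t] iter_meas[of t] assms(2) by simp
  show "AE \<omega> in M. norm (residual t \<omega> * (u t \<omega> \<bullet> (iter t \<omega> - y)))
      \<le> norm ((residual t \<omega>)\<^sup>2 + (norm (iter t \<omega> - y))\<^sup>2)"
    using AE_norm_u[OF assms(2)]
  proof eventually_elim
    case (elim \<omega>)
    let ?r = "\<bar>residual t \<omega>\<bar>" and ?n = "norm (iter t \<omega> - y)"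
    have "\<bar>u t \<omega> \<bullet> (iter t \<omega> - y)\<bar> \<le> ?n"
      using Cauchy_Schwarz_ineq2[of "u t \<omega>" "iter t \<omega> - y"] elim by simp
    then have "\<bar>residual t \<omega> * (u t \<omega> \<bullet> (iter t \<omega> - y))\<bar> \<le> ?r * ?n"
      unfolding abs_mult by (intro mult_left_mono) auto
    also have "\<dots> \<le> ?r\<^sup>2 + ?n\<^sup>2"
    proof -
      have "0 \<le> ?r * ?n" by simp
      moreover have "2 * (?r * ?n) \<le> ?r\<^sup>2 + ?n\<^sup>2"
        using sum_squares_bound[of ?r ?n] by (simp add: mult.assoc)
      ultimately show ?thesis by linarith
    qed
    finally show ?case by simp
  qed
qed

lemma integrable_iter_dist:
  assumes "1 \<le> t" "t \<le> Suc T"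
  shows "integrable M (\<lambda>\<omega>. (norm (iter t \<omega> - y))\<^sup>2)"
  using assms
proof (induction t rule: nat_induct_at_least)
  case base
  then show ?case by (simp add: iter_1)
next
  case (Suc t)
  let ?k = "\<eta> * d / \<alpha>"
  have "integrable M (\<lambda>\<omega>. 2 * (norm (iter t \<omega> - y))\<^sup>2 + 2 * ?k\<^sup>2 * (residual t \<omega>)\<^sup>2)"
    using Suc residual_moment[of t] by simp
  then show ?case
  proof (rule Bochner_Integration.integrable_bound)
    show "(\<lambda>\<omega>. (norm (iter (Suc t) \<omega> - y))\<^sup>2) \<in> borel_measurable M"
      using iter_meas[of "Suc t"] Suc.prems by simp
    have "t \<le> T" using Suc.prems by simp
    from AE_norm_u[OF this]
    show "AE \<omega> in M. norm ((norm (iter (Suc t) \<omega> - y))\<^sup>2)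
        \<le> norm (2 * (norm (iter t \<omega> - y))\<^sup>2 + 2 * ?k\<^sup>2 * (residual t \<omega>)\<^sup>2)"
    proof eventually_elim
      case (elim \<omega>)
      let ?a = "norm (iter t \<omega> - y)" and ?b = "\<bar>?k * residual t \<omega>\<bar>"
      have "iter (Suc t) \<omega> - y = (iter t \<omega> - y) - (?k * residual t \<omega>) *\<^sub>R u t \<omega>"
        by (simp add: iter_Suc[OF Suc.hyps])
      then have "norm (iter (Suc t) \<omega> - y) \<le> ?a + ?b"
        using norm_triangle_ineq4[of "iter t \<omega> - y" "(?k * residual t \<omega>) *\<^sub>R u t \<omega>"]
        by (simp only: norm_scaleR elim mult_1_right)
      then have "(norm (iter (Suc t) \<omega> - y))\<^sup>2 \<le> (?a + ?b)\<^sup>2"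
        by (intro power_mono) auto
      also have "\<dots> \<le> 2 * ?a\<^sup>2 + 2 * ?b\<^sup>2"
        using sum_squares_bound[of ?a ?b] by (simp add: power2_sum)
      also have "\<dots> = 2 * ?a\<^sup>2 + 2 * ?k\<^sup>2 * (residual t \<omega>)\<^sup>2"
        by (simp only: power2_abs power_mult_distrib mult.assoc)
      finally show ?case by simp
    qed
  qed
qed

lemma integrable_gap:
  assumes "1 \<le> t" "t \<le> Suc T"
  shows "integrable M (\<lambda>\<omega>. F (iter t \<omega>) - F y)"
proof (rule Bochner_Integration.integrable_bound)
  show "integrable M (\<lambda>\<omega>. L0 * (1 + (norm (iter t \<omega> - y))\<^sup>2))"
    using integrable_iter_dist[OF assms] by simp
  show "(\<lambda>\<omega>. F (iter t \<omega>) - F y) \<in> borel_measurable M"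
    using iter_meas[OF assms(2)] by measurable
  have "\<bar>F (iter t \<omega>) - F y\<bar> \<le> L0 * (1 + (norm (iter t \<omega> - y))\<^sup>2)" for \<omega>
  proof -
    let ?n = "norm (iter t \<omega> - y)"
    have "\<bar>F (iter t \<omega>) - F y\<bar> \<le> L0 * ?n"
      using lipschitz_onD[OF lipschitz, of "iter t \<omega>" y] by (simp add: dist_real_def dist_norm)
    also have "\<dots> \<le> L0 * (1 + ?n\<^sup>2)"
    proof (rule mult_left_mono)
      show "?n \<le> 1 + ?n\<^sup>2"
        using sum_squares_bound[of 1 ?n] norm_ge_zero[of "iter t \<omega> - y"]
        unfolding one_power2 mult_1_right by linarith
    qed (use L0 in simp)
    finally show ?thesis .
  qed
  then show "AE \<omega> in M. norm (F (iter t \<omega>) - F y) \<le> norm (L0 * (1 + (norm (iter t \<omega> - y))\<^sup>2))"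
    using L0 by (intro AE_I2) (simp add: abs_mult)
qed

text \<open>
  For a fixed state \<open>(z, c)\<close> the noise averages to \<open>F\<close>, and the previous observation \<open>c\<close> drops out
  because the direction has mean zero. What remains is the sphere estimator of \<open>F\<close> at \<open>z\<close>.
\<close>
lemma expected_progress_given_state:
  assumes int: "integrable sample_law (\<lambda>(v, s). (f (z + \<alpha> *\<^sub>R v) s - c) * (v \<bullet> (z - y)))"
  shows "\<alpha> / d * (F z - F y - L0 * \<alpha>) \<le>
    (\<integral>(v, s). (f (z + \<alpha> *\<^sub>R v) s - c) * (v \<bullet> (z - y)) \<partial>sample_law)"
proof -
  interpret R: prob_space "distr N S \<xi>" by (rule prob_space_noise)
  interpret P: pair_sigma_finite "uniform_sphere :: 'a measure" "distr N S \<xi>" ..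
  let ?w = "z - y"
  have contF: "continuous_on UNIV (\<lambda>v. F (z + \<alpha> *\<^sub>R v))"
    by (intro continuous_on_compose2[OF F_cont[of UNIV]] continuous_intros) auto
  have "(\<integral>(v, s). (f (z + \<alpha> *\<^sub>R v) s - c) * (v \<bullet> ?w) \<partial>sample_law)
      = (\<integral>v. \<integral>s. (f (z + \<alpha> *\<^sub>R v) s - c) * (v \<bullet> ?w) \<partial>distr N S \<xi> \<partial>uniform_sphere)"
    using P.integral_fst'[OF int[unfolded sample_law_def]] by (simp add: sample_law_def)
  also have "\<dots> = (\<integral>v. F (z + \<alpha> *\<^sub>R v) * (v \<bullet> ?w) - c * (v \<bullet> ?w) \<partial>uniform_sphere)"
    using R.prob_space
    by (intro Bochner_Integration.integral_cong refl)
      (simp add: integrable_noise_law integral_noise_law left_diff_distrib)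
  also have "\<dots> = (\<integral>v. F (z + \<alpha> *\<^sub>R v) * (v \<bullet> ?w) \<partial>uniform_sphere) - (\<integral>v. c * (v \<bullet> ?w) \<partial>uniform_sphere)"
    by (intro Bochner_Integration.integral_diff integrable_uniform_sphere continuous_intros contF)
  also have "(\<integral>v. c * (v \<bullet> ?w) \<partial>uniform_sphere) = 0"
    by (simp add: uniform_sphere_mean_zero)
  finally have eq: "(\<integral>(v, s). (f (z + \<alpha> *\<^sub>R v) s - c) * (v \<bullet> ?w) \<partial>sample_law)
      = (\<integral>v. F (z + \<alpha> *\<^sub>R v) * (v \<bullet> ?w) \<partial>uniform_sphere)"
    by simp
  have "F z - F y - L0 * \<alpha> \<le> d / \<alpha> * (\<integral>v. F (z + \<alpha> *\<^sub>R v) * (v \<bullet> ?w) \<partial>uniform_sphere)"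
    using sphere_estimator_subgradient[OF convex lipschitz \<alpha>, of z y] by (simp add: d_def)
  then show ?thesis
    unfolding eq using \<alpha> d_pos by (simp add: field_simps)
qed

lemma expected_progress:
  assumes t: "1 \<le> t" "t \<le> T"
  shows "\<alpha> / d * (expectation (\<lambda>\<omega>. F (iter t \<omega>) - F y) - L0 * \<alpha>) \<le>
    expectation (\<lambda>\<omega>. residual t \<omega> * (u t \<omega> \<bullet> (iter t \<omega> - y)))"
proof -
  interpret Q: prob_space sample_law by (rule prob_space_sample_law)
  note [measurable] = u_meas[OF t(2)] \<xi>s_meas[OF t(2)] iter_meas[OF le_SucI[OF t(2)]] prev_obs_meas[OF t(2)]
  let ?X = "\<lambda>\<omega>. (iter t \<omega>, prev_obs t \<omega>)" and ?Z = "\<lambda>\<omega>. (u t \<omega>, \<xi>s t \<omega>)"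
  let ?L = "borel \<Otimes>\<^sub>M borel :: ('a \<times> real) measure" and ?K = "borel \<Otimes>\<^sub>M S :: ('a \<times> 's) measure"
  let ?PX = "distr M ?L ?X"
  interpret PX: prob_space ?PX by (rule prob_space_distr) simp
  interpret P: pair_sigma_finite ?PX sample_law ..
  define \<phi> where "\<phi> p = (f (fst (fst p) + \<alpha> *\<^sub>R fst (snd p)) (snd (snd p)) - snd (fst p))
      * (fst (snd p) \<bullet> (fst (fst p) - y))" for p
  have \<phi>_meas[measurable]: "\<phi> \<in> borel_measurable (?L \<Otimes>\<^sub>M ?K)"
    unfolding \<phi>_def[abs_def] by measurable
  have \<phi>_eq: "\<phi> (?X \<omega>, ?Z \<omega>) = residual t \<omega> * (u t \<omega> \<bullet> (iter t \<omega> - y))" for \<omega>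
    by (simp add: \<phi>_def residual_def obs_def)
  have XZ: "(\<lambda>\<omega>. (?X \<omega>, ?Z \<omega>)) \<in> measurable M (?L \<Otimes>\<^sub>M ?K)"
    by measurable
  have "integrable M (\<lambda>\<omega>. \<phi> (?X \<omega>, ?Z \<omega>))"
    unfolding \<phi>_eq using t by (intro integrable_progress integrable_iter_dist) auto
  then have int: "integrable (?PX \<Otimes>\<^sub>M sample_law) \<phi>"
    unfolding distr_state_sample[OF t(2), symmetric] by (subst integrable_distr_eq[OF XZ \<phi>_meas])
  have gap: "integrable M (\<lambda>\<omega>. F (iter t \<omega>) - F y)"
    using t by (intro integrable_gap) auto
  let ?g = "\<lambda>p :: 'a \<times> real. \<alpha> / d * (F (fst p) - F y - L0 * \<alpha>)"
  have g_meas: "?g \<in> borel_measurable ?L"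
    by measurable
  have X: "?X \<in> measurable M ?L"
    by measurable
  have "\<alpha> / d * (expectation (\<lambda>\<omega>. F (iter t \<omega>) - F y) - L0 * \<alpha>) = expectation (\<lambda>\<omega>. ?g (?X \<omega>))"
    using gap by (simp add: prob_space)
  also have "\<dots> = (\<integral>p. ?g p \<partial>?PX)"
    by (rule integral_distr[OF X g_meas, symmetric])
  also have "\<dots> \<le> (\<integral>p. \<integral>q. \<phi> (p, q) \<partial>sample_law \<partial>?PX)"
  proof (rule integral_mono_AE)
    show "integrable ?PX ?g"
      using gap by (subst integrable_distr_eq[OF X g_meas]) simp
    show "integrable ?PX (\<lambda>p. \<integral>q. \<phi> (p, q) \<partial>sample_law)"
      by (rule P.integrable_fst'[OF int])
    show "AE p in ?PX. ?g p \<le> (\<integral>q. \<phi> (p, q) \<partial>sample_law)"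
      using P.AE_integrable_fst'[OF int]
    proof eventually_elim
      case (elim p)
      obtain z c where p: "p = (z, c)" by (cases p)
      show ?case
        using expected_progress_given_state[of z c y] elim
        by (simp add: p \<phi>_def split_beta')
    qed
  qed
  also have "\<dots> = (\<integral>r. \<phi> r \<partial>(?PX \<Otimes>\<^sub>M sample_law))"
    by (rule P.integral_fst'[OF int])
  also have "\<dots> = expectation (\<lambda>\<omega>. \<phi> (?X \<omega>, ?Z \<omega>))"
    unfolding distr_state_sample[OF t(2), symmetric] by (rule integral_distr[OF XZ \<phi>_meas])
  finally show ?thesis
    by (simp only: \<phi>_eq)
qed

text \<open>
  The squared distance is expanded after one step. The cross term is bounded by the expected
  progress and the quadratic term by the second moment of the residual.
\<close>
lemma expected_descent:
  assumes t: "1 \<le> t" "t \<le> T"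
  shows "expectation (\<lambda>\<omega>. (norm (iter (Suc t) \<omega> - y))\<^sup>2) \<le> expectation (\<lambda>\<omega>. (norm (iter t \<omega> - y))\<^sup>2)
    - 2 * \<eta> * (expectation (\<lambda>\<omega>. F (iter t \<omega>) - F y) - L0 * \<alpha>) + (\<eta> * d / \<alpha>)\<^sup>2 * (18 * \<kappa>)"
proof -
  let ?k = "\<eta> * d / \<alpha>"
  let ?p = "\<lambda>\<omega>. residual t \<omega> * (u t \<omega> \<bullet> (iter t \<omega> - y))"
  have k: "0 < ?k" using \<eta> d_pos \<alpha> by simp
  have dist: "integrable M (\<lambda>\<omega>. (norm (iter s \<omega> - y))\<^sup>2)" if "1 \<le> s" "s \<le> Suc T" for s
    using that by (rule integrable_iter_dist)
  have prog: "integrable M ?p"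
    using t by (intro integrable_progress dist) auto
  have res: "integrable M (\<lambda>\<omega>. (residual t \<omega>)\<^sup>2)" "expectation (\<lambda>\<omega>. (residual t \<omega>)\<^sup>2) \<le> 18 * \<kappa>"
    using residual_moment[OF t] by simp_all
  have "expectation (\<lambda>\<omega>. (norm (iter (Suc t) \<omega> - y))\<^sup>2)
      = expectation (\<lambda>\<omega>. (norm (iter t \<omega> - y))\<^sup>2 - 2 * ?k * ?p \<omega> + ?k\<^sup>2 * (residual t \<omega>)\<^sup>2)"
  proof (rule integral_cong_AE)
    show "(\<lambda>\<omega>. (norm (iter (Suc t) \<omega> - y))\<^sup>2) \<in> borel_measurable M"
      using dist[of "Suc t"] t by auto
    show "(\<lambda>\<omega>. (norm (iter t \<omega> - y))\<^sup>2 - 2 * ?k * ?p \<omega> + ?k\<^sup>2 * (residual t \<omega>)\<^sup>2) \<in> borel_measurable M"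
      using dist[of t] t prog res by (intro borel_measurable_integrable) auto
    show "AE \<omega> in M. (norm (iter (Suc t) \<omega> - y))\<^sup>2
        = (norm (iter t \<omega> - y))\<^sup>2 - 2 * ?k * ?p \<omega> + ?k\<^sup>2 * (residual t \<omega>)\<^sup>2"
      using AE_norm_u[OF t(2)]
    proof eventually_elim
      case (elim \<omega>)
      define w c where "w = iter t \<omega> - y" and "c = ?k * residual t \<omega>"
      have "iter (Suc t) \<omega> - y = w - c *\<^sub>R u t \<omega>"
        by (simp add: iter_Suc[OF t(1)] w_def c_def)
      moreover have "(norm (w - c *\<^sub>R u t \<omega>))\<^sup>2 = (norm w)\<^sup>2 - 2 * c * (u t \<omega> \<bullet> w) + c\<^sup>2 * (norm (u t \<omega>))\<^sup>2"
        unfolding power2_norm_eq_inner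
        by (simp add: inner_diff_left inner_diff_right inner_commute[of w "u t \<omega>"] power2_eq_square algebra_simps)
      ultimately have "(norm (iter (Suc t) \<omega> - y))\<^sup>2 = (norm w)\<^sup>2 - 2 * c * (u t \<omega> \<bullet> w) + c\<^sup>2"
        by (simp only: elim one_power2 mult_1_right)
      then show ?case
        by (simp add: w_def c_def power_mult_distrib power_divide mult_ac)
    qed
  qed
  also have "\<dots> = expectation (\<lambda>\<omega>. (norm (iter t \<omega> - y))\<^sup>2) - 2 * ?k * expectation ?p
      + ?k\<^sup>2 * expectation (\<lambda>\<omega>. (residual t \<omega>)\<^sup>2)"
    using dist[of t] t prog res by simp
  also have "\<dots> \<le> expectation (\<lambda>\<omega>. (norm (iter t \<omega> - y))\<^sup>2)
      - 2 * ?k * (\<alpha> / d * (expectation (\<lambda>\<omega>. F (iter t \<omega>) - F y) - L0 * \<alpha>)) + ?k\<^sup>2 * (18 * \<kappa>)"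
    using k res(2) expected_progress[OF t, of y]
    by (intro add_mono diff_mono mult_left_mono order_refl) auto
  also have "2 * ?k * (\<alpha> / d * (expectation (\<lambda>\<omega>. F (iter t \<omega>) - F y) - L0 * \<alpha>))
      = 2 * \<eta> * (expectation (\<lambda>\<omega>. F (iter t \<omega>) - F y) - L0 * \<alpha>)"
    using \<alpha> d_pos by simp
  finally show ?thesis .
qed

text \<open>
  The squared distances telescope, and the last one is dropped.
\<close>
lemma average_gap:
  assumes T: "T \<ge> 1"
  shows "1 / T * (\<Sum>t=1..T. expectation (\<lambda>\<omega>. F (iter t \<omega>) - F y)) \<le>
    (norm (x1 - y))\<^sup>2 / (2 * real T * \<eta>) + 9 * \<eta> * (c0 * d * L0\<^sup>2 + d\<^sup>2 * \<sigma>0\<^sup>2 / \<alpha>\<^sup>2) + L0 * \<alpha>"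
proof -
  define \<Delta> where "\<Delta> t = expectation (\<lambda>\<omega>. F (iter t \<omega>) - F y)" for t
  define R where "R t = expectation (\<lambda>\<omega>. (norm (iter t \<omega> - y))\<^sup>2)" for t
  define V where "V = (\<eta> * d / \<alpha>)\<^sup>2 * (18 * \<kappa>)"
  have "(\<Sum>t=1..T. 2 * \<eta> * (\<Delta> t - L0 * \<alpha>) - V) \<le> (\<Sum>t=1..T. R t - R (Suc t))"
    using expected_descent[of _ y] by (intro sum_mono) (force simp: \<Delta>_def R_def V_def)
  also have "\<dots> = R 1 - R (Suc T)"
    using sum_Suc_diff[of 1 T "\<lambda>t. - R t"] by simp
  also have "\<dots> \<le> (norm (x1 - y))\<^sup>2"
    by (simp add: R_def iter_1 prob_space)
  finally have "2 * \<eta> * (\<Sum>t=1..T. \<Delta> t) \<le> (norm (x1 - y))\<^sup>2 + T * V + T * (2 * \<eta> * (L0 * \<alpha>))"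
    by (simp add: sum_subtractf right_diff_distrib flip: sum_distrib_left)
  then have "1 / T * (\<Sum>t=1..T. \<Delta> t) \<le> ((norm (x1 - y))\<^sup>2 + T * V + T * (2 * \<eta> * (L0 * \<alpha>))) / (2 * \<eta> * T)"
    using \<eta> T by (simp add: field_simps)
  also have "\<dots> = (norm (x1 - y))\<^sup>2 / (2 * real T * \<eta>) + V / (2 * \<eta>) + L0 * \<alpha>"
    using \<eta> T by (simp add: field_simps)
  also have "V / (2 * \<eta>) = 9 * \<eta> * (c0 * d * L0\<^sup>2 + d\<^sup>2 * \<sigma>0\<^sup>2 / \<alpha>\<^sup>2)"
    using \<eta> \<alpha> d_pos by (simp add: V_def \<kappa>_def field_simps power2_eq_square)
  finally show ?thesis
    by (simp add: \<Delta>_def)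
qed

end

theorem theorem11:
  fixes N :: "'v measure" and S :: "'s measure" and \<xi> :: "'v \<Rightarrow> 's"
    and f :: "real ^ 'n \<Rightarrow> 's \<Rightarrow> real" and F :: "real ^ 'n \<Rightarrow> real"
    and M :: "'w measure" and u :: "nat \<Rightarrow> 'w \<Rightarrow> real ^ 'n" and \<xi>s :: "nat \<Rightarrow> 'w \<Rightarrow> 's"
    and x1 xstar :: "real ^ 'n" and c0 L0 \<sigma>0 \<alpha> \<eta> :: real and T :: nat
    and x :: "nat \<Rightarrow> 'w \<Rightarrow> real ^ 'n"
  assumes c0: "c0 > 0" "sphere_moment_constant c0"
    \<comment> \<open>the random objective and its expectation\<close>
    and N: "prob_space N"
    and \<xi>: "\<xi> \<in> measurable N S"
    and f_meas: "(\<lambda>(z, s). f z s) \<in> borel_measurable (borel \<Otimes>\<^sub>M S)"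
    and f_int: "\<And>z. integrable N (\<lambda>\<omega>. f z (\<xi> \<omega>))"
    and F: "\<And>z. F z = prob_space.expectation N (\<lambda>\<omega>. f z (\<xi> \<omega>))"
    and convex: "convex_on UNIV F"
    and L0: "L0 > 0" and lipschitz: "L0-lipschitz_on UNIV F"
    and xstar: "\<And>z. F xstar \<le> F z"
    and \<sigma>0: "\<sigma>0 > 0"
    and var_int: "\<And>z. integrable N (\<lambda>\<omega>. (f z (\<xi> \<omega>) - F z)\<^sup>2)"
    and var: "\<And>z. prob_space.expectation N (\<lambda>\<omega>. (f z (\<xi> \<omega>) - F z)\<^sup>2) \<le> \<sigma>0\<^sup>2"
    \<comment> \<open>the random directions and noise samples\<close>
    and M: "prob_space M"
    and u_indep: "prob_space.indep_vars M (\<lambda>_. borel) u {..T}"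
    and u_distr: "\<And>t. t \<le> T \<Longrightarrow> distr M borel (u t) = uniform_sphere"
    and \<xi>s_indep: "prob_space.indep_vars M (\<lambda>_. S) \<xi>s {..T}"
    and \<xi>s_distr: "\<And>t. t \<le> T \<Longrightarrow> distr M S (\<xi>s t) = distr N S \<xi>"
    and u_\<xi>s_indep: "indep_rv M
          (\<Pi>\<^sub>M t\<in>{..T}. borel) (\<lambda>\<omega>. \<lambda>t\<in>{..T}. u t \<omega>)
          (\<Pi>\<^sub>M t\<in>{..T}. S) (\<lambda>\<omega>. \<lambda>t\<in>{..T}. \<xi>s t \<omega>)"
    \<comment> \<open>the algorithm\<close>
    and T: "T \<ge> 1"
    and \<alpha>: "\<alpha> > 0"
    and \<eta>: "0 < \<eta>" "\<eta> \<le> \<alpha> / (3 * real CARD('n) * L0)"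
    and x: "\<And>t \<omega>. x t \<omega> = residual_iterate f \<eta> \<alpha> x1 (\<lambda>i. u i \<omega>) (\<lambda>i. \<xi>s i \<omega>) t"
  shows "(\<forall>t\<in>{1..T}. integrable M (\<lambda>\<omega>. F (x t \<omega>) - F xstar)) \<and>
    (1 / real T) * (\<Sum>t=1..T. prob_space.expectation M (\<lambda>\<omega>. F (x t \<omega>) - F xstar))
      \<le> (norm (x1 - xstar))\<^sup>2 / (real T * \<eta>) + 24 * \<eta> * c0 * real CARD('n) * L0\<^sup>2
        + 24 * \<eta> * (real CARD('n))\<^sup>2 * \<sigma>0\<^sup>2 / \<alpha>\<^sup>2 + L0 * \<alpha>"
proof -
  have dim: "DIM(real ^ 'n) = CARD('n)"
    by simp
  interpret N: prob_space N by (rule N)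
  interpret M: prob_space M by (rule M)
  interpret A: residual_feedback M N S \<xi> f F u \<xi>s x1 c0 L0 \<sigma>0 \<alpha> \<eta> T
    by unfold_locales (unfold dim, fact+)
  have x_iter: "x t \<omega> = A.iter t \<omega>" for t \<omega>
    by (simp add: x A.iter_def)
  have d: "A.d = real CARD('n)"
    by (simp add: A.d_def dim)
  have "\<forall>t\<in>{1..T}. integrable M (\<lambda>\<omega>. F (x t \<omega>) - F xstar)"
    unfolding x_iter using A.integrable_gap by auto
  moreover have "1 / real T * (\<Sum>t=1..T. M.expectation (\<lambda>\<omega>. F (x t \<omega>) - F xstar))
      \<le> (norm (x1 - xstar))\<^sup>2 / (2 * real T * \<eta>) + 9 * \<eta> * (c0 * A.d * L0\<^sup>2 + A.d\<^sup>2 * \<sigma>0\<^sup>2 / \<alpha>\<^sup>2) + L0 * \<alpha>"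
    unfolding x_iter by (rule A.average_gap[OF T])
  moreover have "(norm (x1 - xstar))\<^sup>2 / (2 * real T * \<eta>) \<le> (norm (x1 - xstar))\<^sup>2 / (T * \<eta>)"
    using T \<eta> by (intro divide_left_mono) auto
  moreover have "9 * \<eta> * (c0 * A.d * L0\<^sup>2 + A.d\<^sup>2 * \<sigma>0\<^sup>2 / \<alpha>\<^sup>2)
      \<le> 24 * \<eta> * (c0 * A.d * L0\<^sup>2 + A.d\<^sup>2 * \<sigma>0\<^sup>2 / \<alpha>\<^sup>2)"
    using \<eta> c0 A.d_pos by (intro mult_right_mono) auto
  moreover have "24 * \<eta> * (c0 * A.d * L0\<^sup>2 + A.d\<^sup>2 * \<sigma>0\<^sup>2 / \<alpha>\<^sup>2)
      = 24 * \<eta> * c0 * CARD('n) * L0\<^sup>2 + 24 * \<eta> * (real CARD('n))\<^sup>2 * \<sigma>0\<^sup>2 / \<alpha>\<^sup>2"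
    by (simp add: d algebra_simps)
  ultimately show ?thesis
    by (intro conjI) (assumption, linarith)
qed

end
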